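(* Let $(M,\eta_{ab})$ be Minkowski spacetime, let $\xi^a$ be a constant unit timelike vector field on $M$ (the 4-velocity of the medium), let $\varepsilon,\mu>0$ be constants, and let $n=\sqrt{\varepsilon\mu}$ be the (constant) index of refraction. Let $B\xrightarrow{\pi}M$ be the bundle of antisymmetric rank-2 covariant tensors $F_{ab}$ over $M$, and consider the source-free macroscopic Maxwell equations for a linear, homogeneous, isotropic, non-dispersive medium, written as the first-order system $$\tilde\eta^{an}\nabla_aF_{nb}=0,\qquad \nabla_{[a}F_{bc]}=0,\qquad \tilde\eta^{ab}=\eta^{ab}-(1-n^2)\xi^a\xi^b,$$ with associated tensor field $k_A{}^m{}_{\alpha'}$ as given in the context. Let $\zeta^a$ be a smooth assignment, to each point $x\in B$, of a vector at $\pi(x)$ that is timelike relative to $\tilde\eta_{ab}$ (the inverse of $\tilde\eta^{ab}$), and define $h^A{}_{\alpha'}$ by $$h^A{}_{\alpha'}\,\delta\phi^{\alpha'}=\Big(\delta F^a{}_m\zeta^m,\ \tfrac32\,\zeta^{[a}\delta F^{bc]}\Big)$$ for vertical vectors $\delta\phi^{\alpha'}=\delta F_{ab}$, where indices are raised with $\tilde\eta^{ab}$. Then: 1. $h^A{}_{\alpha'}$ is a hyperbolization of this system, and for every $x\in B$ the set $s_x$ consists precisely of the $\tilde\eta$-timelike covectors at $\pi(x)$ co-oriented with $\zeta^a$, so that the causal cone $C_x$ consists precisely of the $\tilde\eta$-causal vectors at $\pi(x)$ co-oriented with $\zeta^a$ (together with the zero vector). 2. If $n>1$, then for every $x\in B$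 the causal cone $C_x$ is narrower than the metric lightcone: it is a proper subset of one lobe of the metric lightcone of $\eta_{ab}$ at $\pi(x)$. 3. If $n<1$, then for every $x\in B$ the causal cone $C_x$ is wider than the metric lightcone: it contains as a proper subset one lobe of the metric lightcone of $\eta_{ab}$ at $\pi(x)$. In particular, for $n<1$ the system satisfies the Geroch-Earman criterion, i.e. its solutions may propagate superluminally.
   Context: **Conventions.** Minkowski spacetime $(M,\eta_{ab})$ has $M=\mathbb{R}^4$, with $\eta_{ab}$ flat and geodesically complete, of signature $(1,3)$ (timelike vectors have positive norm). $\nabla$ is its Levi-Civita derivative operator. A vector is causal relative to a Lorentzian metric if it is timelike or null relative to it. A covector $n_a$ is $\tilde\eta$-timelike if $\tilde\eta^{ab}n_an_b>0$. It is co-oriented with the $\tilde\eta$-timelike vector $\zeta^a$ if $n_a\zeta^a>0$. A nonzero $\tilde\eta$-causal vector $v^a$ is co-oriented with $\zeta^a$ if $\tilde\eta_{ab}v^a\zeta^b>0$. Explicitly, $\tilde\eta_{ab}=\eta_{ab}+\frac{1-n^2}{n^2}\xi_a\xi_b$ (Gordon's metric), where $\xi_a=\eta_{ab}\xi^b$. A lobe of the metric lightcone of $\eta_{ab}$ at a point is one of the two connected components of the set of nonzero $\eta$-causal vectors there, together with $0$. **Macroscopic Maxwell equations.** Without external sources these are $\nabla_aP^{ab}=0$ and $\nabla_{[a}F_{bc]}=0$ (here indices are raised with $\eta^{ab}$), where $$F_{ab}=2E_{[a}\xi_{b]}+\epsilon_{ab}{}^{cd}\xi_cB_d,\qquad P_{ab}=2D_{[a}\xi_{b]}+\epsilon_{ab}{}^{cd}\xi_cH_d,$$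 with constitutive relations $D_a=\varepsilon E_a$ and $B_a=\mu H_a$. Thus $P_{ab}=\frac1\mu\left(2(1-n^2)\xi_{[a}F_{b]m}\xi^m+F_{ab}\right)$, and the equations for $F_{ab}$ can be rewritten in the form displayed in the claim. **First-order systems.** Each fiber of $B$ is the 6-dimensional vector space of antisymmetric tensors at a point of $M$, so a vertical vector $\delta\phi^{\alpha'}$ at $x\in B$ (one tangent to the fiber) is identified with an antisymmetric tensor $\delta F_{ab}$ at $\pi(x)$. The index $A$ refers to the 8-dimensional "space of equations", whose vectors are pairs $\sigma^A=(s^a,s^{abc})$ with $s^{abc}=s^{[abc]}$. The system is encoded by the field $k_A{}^m{}_{\alpha'}$ on $B$ defined, for any covector $n_m$ at $\pi(x)$ and vertical vector $\delta\hat\phi^{\alpha'}=\delta\hat F_{ab}$, by $$k_A{}^m{}_{\alpha'}\sigma^An_m\delta\hat\phi^{\alpha'}=s^a\left(-\tilde\eta^{bm}n_m\,\delta\hat F_{ab}\right)+s^{abc}\left(n_{[a}\delta\hat F_{bc]}\right).$$ **Hyperbolization and causal cone.** A hyperbolization is a smooth field $h^A{}_{\beta'}$ on $B$ such that (i) $h^A{}_{\beta'}k_A{}^m{}_{\alpha'}$ is symmetric in $\alpha',\beta'$, and (ii) at each $x\in B$ there is a covector $n_m$ at $\pi(x)$ for which $n_mh^A{}_{\beta'}k_A{}^m{}_{\alpha'}$ is positive definite on vertical vectors, i.e. $n_mh^A{}_{\beta'}k_A{}^m{}_{\alpha'}v^{\alpha'}v^{\beta'}>0$ for all nonzero vertical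 $v^{\alpha'}$. Given a hyperbolization, $s_x$ is the set of covectors $n_m$ at $\pi(x)$ for which $n_mh^A{}_{\beta'}k_A{}^m{}_{\alpha'}$ is positive definite. The causal cone is $$C_x=\{v^a \text{ at } \pi(x): v^an_a\ge 0 \text{ for all } n_a\in s_x\}.$$ **Geroch-Earman criterion.** Given a system with a fixed hyperbolization on sections of a bundle $B\to M$ over a spacetime $(M,g_{ab})$, solutions may propagate superluminally if and only if there is an open set $O\subseteq B$ such that for all $x\in O$, $C_x$ contains as a proper subset one lobe of the metric lightcone of $g_{ab}$ at $\pi(x)$. *)

theory Defs
  imports "HOL-Analysis.Analysis"
begin

text \<open>
  Minkowski spacetime is \<open>real ^ 4\<close> in global inertial coordinates, with \<open>0 :: 4\<close> the time
  coordinate. Every tangent and cotangent space is then \<open>real ^ 4\<close>, the pairing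
  \<open>n\<^sub>a v\<^sup>a\<close> of a covector with a vector is \<open>n \<bullet> v\<close>, rank-2 tensors are matrices
  (\<open>F $ a $ b\<close> is the component with indices \<open>a b\<close>), and for a metric \<open>g\<close> the number
  \<open>g\<^sub>a\<^sub>b u\<^sup>a v\<^sup>b\<close> is \<open>u \<bullet> (g *v v)\<close>.
\<close>

type_synonym vec4 = "real ^ 4"
type_synonym tensor2 = "real ^ 4 ^ 4"
type_synonym tensor3 = "real ^ 4 ^ 4 ^ 4"

text \<open>The matrix \<open>eta\<close> is its own inverse, so it also gives the components \<open>\<eta>\<^sup>a\<^sup>b\<close>.\<close>

definition eta :: tensor2 where
  "eta = (\<chi> a b. if a \<noteq> b then 0 else if a = 0 then 1 else - 1)"

definition timelike :: "tensor2 \<Rightarrow> vec4 \<Rightarrow> bool" where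
  "timelike g v \<longleftrightarrow> v \<bullet> (g *v v) > 0"

definition null_vector :: "tensor2 \<Rightarrow> vec4 \<Rightarrow> bool" where
  "null_vector g v \<longleftrightarrow> v \<bullet> (g *v v) = 0"

definition causal :: "tensor2 \<Rightarrow> vec4 \<Rightarrow> bool" where
  "causal g v \<longleftrightarrow> timelike g v \<or> null_vector g v"

definition lightcone_lobe :: "tensor2 \<Rightarrow> vec4 set \<Rightarrow> bool" where
  "lightcone_lobe g L \<longleftrightarrow> (\<exists>K \<in> components {v. v \<noteq> 0 \<and> causal g v}. L = insert 0 K)"

text \<open>Gordon's metric \<open>\<eta>\<^sub>a\<^sub>b + ((1 - n\<^sup>2) / n\<^sup>2) \<xi>\<^sub>a \<xi>\<^sub>b\<close> and its inverse; see \<open>gordon_inverse\<close>.\<close>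

definition gordon_up :: "real \<Rightarrow> vec4 \<Rightarrow> tensor2" where
  "gordon_up n \<xi> = (\<chi> a b. eta $ a $ b - (1 - n\<^sup>2) * \<xi> $ a * \<xi> $ b)"

definition gordon :: "real \<Rightarrow> vec4 \<Rightarrow> tensor2" where
  "gordon n \<xi> = (\<chi> a b. eta $ a $ b + (1 - n\<^sup>2) / n\<^sup>2 * (eta *v \<xi>) $ a * (eta *v \<xi>) $ b)"

text \<open>\<open>alt3 T\<close> is \<open>T\<^bsub>[abc]\<^esub>\<close>.\<close>

definition alt3 :: "tensor3 \<Rightarrow> tensor3" where
  "alt3 T = (\<chi> a b c. (T $ a $ b $ c + T $ b $ c $ a + T $ c $ a $ b
                      - T $ b $ a $ c - T $ a $ c $ b - T $ c $ b $ a) / 6)"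

definition outer :: "vec4 \<Rightarrow> tensor2 \<Rightarrow> tensor3" where
  "outer n F = (\<chi> a b c. n $ a * F $ b $ c)"


section \<open>The bundle and the space of equations\<close>

definition antisym_tensors :: "tensor2 set" where
  "antisym_tensors = {F. transpose F = - F}"

text \<open>
  The bundle is the product of spacetime with the fiber \<open>antisym_tensors\<close>, with projection
  \<open>fst\<close>; vertical vectors at any of its points are the elements of \<open>antisym_tensors\<close>.
\<close>

definition em_bundle :: "(vec4 \<times> tensor2) set" where
  "em_bundle = UNIV \<times> antisym_tensors"

definition equation_space :: "(vec4 \<times> tensor3) set" where
  "equation_space = {(s, t). t = alt3 t}"

text \<open>
  \<open>C_k k S f\<close> is meant for a linear subspace \<open>S\<close> (here \<open>em_bundle\<close>): only directions \<open>v \<in> S\<close>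
  are differentiated along, and in these the derivative within \<open>S\<close> is unique.
\<close>

primrec C_k :: "nat \<Rightarrow> 'a::real_normed_vector set \<Rightarrow> ('a \<Rightarrow> 'b::real_normed_vector) \<Rightarrow> bool" where
  "C_k 0 S f \<longleftrightarrow> continuous_on S f"
| "C_k (Suc k) S f \<longleftrightarrow>
     (\<exists>f'. (\<forall>x\<in>S. (f has_derivative f' x) (at x within S)) \<and> (\<forall>v\<in>S. C_k k S (\<lambda>x. f' x v)))"

definition smooth_on_subspace ::
    "'a::real_normed_vector set \<Rightarrow> ('a \<Rightarrow> 'b::real_normed_vector) \<Rightarrow> bool" where
  "smooth_on_subspace S f \<longleftrightarrow> (\<forall>k. C_k k S f)"


section \<open>First-order systems, hyperbolizations and causal cones\<close>

text \<open>
  A system is given by \<open>k x \<sigma> n \<phi>\<close>, standing for the full contraction of \<open>k\<close> at \<open>x\<close> with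
  \<open>\<sigma> \<in> equation_space\<close>, a covector \<open>n\<close> and a vertical vector \<open>\<phi>\<close>. A field \<open>h\<close> with an upper
  equation index and a lower vertical index is given by \<open>h x \<phi>\<close>.
\<close>

type_synonym system = "vec4 \<times> tensor2 \<Rightarrow> vec4 \<times> tensor3 \<Rightarrow> vec4 \<Rightarrow> tensor2 \<Rightarrow> real"
type_synonym equation_map = "vec4 \<times> tensor2 \<Rightarrow> tensor2 \<Rightarrow> vec4 \<times> tensor3"

definition smooth_equation_map :: "equation_map \<Rightarrow> bool" where
  "smooth_equation_map h \<longleftrightarrow>
     (\<forall>x\<in>em_bundle. \<forall>\<phi>\<in>antisym_tensors. h x \<phi> \<in> equation_space) \<and>
     (\<forall>x\<in>em_bundle. \<forall>\<phi>\<in>antisym_tensors. \<forall>\<psi>\<in>antisym_tensors. \<forall>r s.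
        h x (r *\<^sub>R \<phi> + s *\<^sub>R \<psi>) = r *\<^sub>R h x \<phi> + s *\<^sub>R h x \<psi>) \<and>
     (\<forall>\<phi>\<in>antisym_tensors. smooth_on_subspace em_bundle (\<lambda>x. h x \<phi>))"

definition positive_covectors :: "system \<Rightarrow> equation_map \<Rightarrow> vec4 \<times> tensor2 \<Rightarrow> vec4 set" where
  "positive_covectors k h x = {n. \<forall>\<phi>\<in>antisym_tensors. \<phi> \<noteq> 0 \<longrightarrow> k x (h x \<phi>) n \<phi> > 0}"

definition hyperbolization :: "system \<Rightarrow> equation_map \<Rightarrow> bool" where
  "hyperbolization k h \<longleftrightarrow>
     smooth_equation_map h \<and>
     (\<forall>x\<in>em_bundle. \<forall>n. \<forall>\<phi>\<in>antisym_tensors. \<forall>\<psi>\<in>antisym_tensors.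
        k x (h x \<phi>) n \<psi> = k x (h x \<psi>) n \<phi>) \<and>
     (\<forall>x\<in>em_bundle. \<exists>n. n \<in> positive_covectors k h x)"

definition causal_cone :: "system \<Rightarrow> equation_map \<Rightarrow> vec4 \<times> tensor2 \<Rightarrow> vec4 set" where
  "causal_cone k h x = {v. \<forall>n \<in> positive_covectors k h x. v \<bullet> n \<ge> 0}"

text \<open>
  The open set is required to be nonempty, since otherwise the criterion would hold vacuously.
\<close>

definition geroch_earman_superluminal ::
    "(vec4 \<Rightarrow> tensor2) \<Rightarrow> system \<Rightarrow> equation_map \<Rightarrow> bool" where
  "geroch_earman_superluminal g k h \<longleftrightarrow>
     (\<exists>U. openin (top_of_set em_bundle) U \<and> U \<noteq> {} \<and>
        (\<forall>x\<in>U. \<exists>L. lightcone_lobe (g (fst x)) L \<and> L \<subset> causal_cone k h x))"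


section \<open>Maxwell's equations in a medium\<close>

definition maxwell_k :: "real \<Rightarrow> vec4 \<Rightarrow> system" where
  "maxwell_k n \<xi> x \<sigma> m \<phi> =
     fst \<sigma> \<bullet> (- (\<phi> *v (gordon_up n \<xi> *v m))) + snd \<sigma> \<bullet> alt3 (outer m \<phi>)"

definition maxwell_h :: "real \<Rightarrow> vec4 \<Rightarrow> (vec4 \<times> tensor2 \<Rightarrow> vec4) \<Rightarrow> equation_map" where
  "maxwell_h n \<xi> \<zeta> x \<phi> =
     (gordon_up n \<xi> *v (\<phi> *v \<zeta> x),
      (3 / 2) *\<^sub>R alt3 (outer (\<zeta> x) (gordon_up n \<xi> ** \<phi> ** transpose (gordon_up n \<xi>))))"

text \<open>
  The differential equations behind \<open>maxwell_k\<close>. In inertial coordinates the Levi-Civita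
  derivative is the coordinate derivative \<open>pd\<close>.
\<close>

definition pd :: "(vec4 \<Rightarrow> 'a::real_normed_vector) \<Rightarrow> 4 \<Rightarrow> vec4 \<Rightarrow> 'a" where
  "pd F a p = frechet_derivative F (at p) (axis a 1)"

definition solves_system :: "system \<Rightarrow> (vec4 \<Rightarrow> tensor2) \<Rightarrow> bool" where
  "solves_system k F \<longleftrightarrow>
     (\<forall>p. \<forall>\<sigma>\<in>equation_space. (\<Sum>m\<in>UNIV. k (p, F p) \<sigma> (axis m 1) (pd F m p)) = 0)"

definition first_order_maxwell :: "real \<Rightarrow> vec4 \<Rightarrow> (vec4 \<Rightarrow> tensor2) \<Rightarrow> bool" where
  "first_order_maxwell n \<xi> F \<longleftrightarrow>
     (\<forall>p b. (\<Sum>a\<in>UNIV. \<Sum>m\<in>UNIV. gordon_up n \<xi> $ a $ m * pd F a p $ m $ b) = 0) \<and>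
     (\<forall>p. alt3 (\<chi> a. pd F a p) = 0)"

definition levi_civita :: "4 \<Rightarrow> 4 \<Rightarrow> 4 \<Rightarrow> 4 \<Rightarrow> real" where
  "levi_civita a b c d =
     det (\<chi> i. axis (if i = 0 then a else if i = 1 then b else if i = 2 then c else d) 1 :: tensor2)"

text \<open>\<open>2 E\<^bsub>[a\<^esub> \<xi>\<^bsub>b]\<^esub> + \<epsilon>\<^bsub>ab\<^esub>\<^bsup>cd\<^esup> \<xi>\<^sub>c B\<^sub>d\<close>, where \<open>\<xi>\<close> is a vector and \<open>E\<close>, \<open>B\<close> are covectors.\<close>

definition field_tensor :: "vec4 \<Rightarrow> vec4 \<Rightarrow> vec4 \<Rightarrow> tensor2" where
  "field_tensor \<xi> E B =
     (\<chi> a b. E $ a * (eta *v \<xi>) $ b - E $ b * (eta *v \<xi>) $ a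
       + (\<Sum>c\<in>UNIV. \<Sum>d\<in>UNIV. levi_civita a b c d * (eta *v (eta *v \<xi>)) $ c * (eta *v B) $ d))"

definition macroscopic_maxwell ::
    "real \<Rightarrow> real \<Rightarrow> vec4 \<Rightarrow> (vec4 \<Rightarrow> vec4) \<Rightarrow> (vec4 \<Rightarrow> vec4) \<Rightarrow> bool" where
  "macroscopic_maxwell \<epsilon> \<mu> \<xi> E B \<longleftrightarrow>
     (let F = (\<lambda>p. field_tensor \<xi> (E p) (B p));
          P = (\<lambda>p. field_tensor \<xi> (\<epsilon> *\<^sub>R E p) ((1 / \<mu>) *\<^sub>R B p))
      in (\<forall>p b. (\<Sum>a\<in>UNIV. pd (\<lambda>p. eta ** P p ** transpose eta) a p $ a $ b) = 0) \<and>
         (\<forall>p. alt3 (\<chi> a. pd F a p) = 0))"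


section \<open>Consistency of the definitions\<close>

lemma eta_eta: "eta ** eta = mat 1"
proof -
  have "(\<Sum>k\<in>UNIV. eta $ a $ k * eta $ k $ b) = (if a = b then 1 else 0)" for a b
    by (subst sum.remove[of _ a]) (auto simp: eta_def intro!: sum.neutral)
  then show ?thesis
    by (simp add: matrix_matrix_mult_def mat_def vec_eq_iff)
qed

lemma transpose_eta: "transpose eta = eta"
  by (auto simp: eta_def transpose_def vec_eq_iff)

lemma eta_eta_component: "(\<Sum>k\<in>UNIV. eta $ a $ k * eta $ k $ b) = (if a = b then 1 else 0)"
  using arg_cong[OF eta_eta, of "\<lambda>M. M $ a $ b"] by (simp add: matrix_matrix_mult_def mat_def)

lemma eta_sym: "eta $ a $ b = eta $ b $ a"
  by (auto simp: eta_def)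

lemma eta_mult_eta: "eta *v (eta *v x) = x"
  by (simp add: matrix_vector_mul_assoc eta_eta)

lemma eta_vec: "(\<Sum>k\<in>UNIV. eta $ a $ k * x $ k) = (eta *v x) $ a"
  by (simp add: matrix_vector_mult_def)

lemma vec_eta: "(\<Sum>k\<in>UNIV. x $ k * eta $ k $ a) = (eta *v x) $ a"
  by (simp add: matrix_vector_mult_def eta_sym[of _ a] mult.commute)

lemma gordon_inverse:
  assumes "\<xi> \<bullet> (eta *v \<xi>) = 1" "n \<noteq> 0"
  shows "gordon n \<xi> ** gordon_up n \<xi> = mat 1" "gordon_up n \<xi> ** gordon n \<xi> = mat 1"
proof -
  define w where "w = eta *v \<xi>"
  define c where "c = (1 - n\<^sup>2) / n\<^sup>2"
  define d where "d = 1 - n\<^sup>2"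
  have cd: "- d + c - c * d = 0"
    using assms(2) by (simp add: c_def d_def field_simps power2_eq_square)
  have ww: "(\<Sum>k\<in>UNIV. w $ k * \<xi> $ k) = 1"
    using assms(1) by (simp add: inner_vec_def w_def mult.commute)
  have ew: "eta *v w = \<xi>"
    by (simp add: w_def eta_mult_eta)
  have "(gordon n \<xi> ** gordon_up n \<xi>) $ a $ b = mat 1 $ a $ b" for a b
  proof -
    have "(gordon n \<xi> ** gordon_up n \<xi>) $ a $ b
        = (\<Sum>k\<in>UNIV. (eta $ a $ k + c * w $ a * w $ k) * (eta $ k $ b - d * \<xi> $ k * \<xi> $ b))"
      by (simp add: matrix_matrix_mult_def gordon_def gordon_up_def w_def c_def d_def)
    also have "\<dots> = (\<Sum>k\<in>UNIV. eta $ a $ k * eta $ k $ b)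
        - d * \<xi> $ b * (\<Sum>k\<in>UNIV. eta $ a $ k * \<xi> $ k)
        + c * w $ a * (\<Sum>k\<in>UNIV. w $ k * eta $ k $ b)
        - c * d * w $ a * \<xi> $ b * (\<Sum>k\<in>UNIV. w $ k * \<xi> $ k)"
      unfolding sum_distrib_left sum.distrib[symmetric] sum_subtractf[symmetric]
      by (rule sum.cong) (auto simp: algebra_simps)
    also have "\<dots> = (if a = b then 1 else 0) + w $ a * \<xi> $ b * (- d + c - c * d)"
      unfolding eta_eta_component eta_vec vec_eta ww ew w_def[symmetric]
      by (simp add: algebra_simps)
    finally show ?thesis
      unfolding cd by (simp add: mat_def)
  qed
  then show "gordon n \<xi> ** gordon_up n \<xi> = mat 1"
    by (simp add: vec_eq_iff)
  then show "gordon_up n \<xi> ** gordon n \<xi> = mat 1"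
    by (simp add: matrix_left_right_inverse)
qed

lemma pd_bounded_linear:
  assumes "bounded_linear L" "F differentiable (at p)"
  shows "pd (\<lambda>p. L (F p)) a p = L (pd F a p)"
proof -
  have "(F has_derivative frechet_derivative F (at p)) (at p)"
    using assms(2) by (simp add: frechet_derivative_works)
  then have "((\<lambda>p. L (F p)) has_derivative (\<lambda>v. L (frechet_derivative F (at p) v))) (at p)"
    by (rule bounded_linear.has_derivative[OF assms(1)])
  from frechet_derivative_at[OF this] show ?thesis
    by (simp add: pd_def fun_eq_iff)
qed

lemma bounded_linear_transpose: "bounded_linear (transpose :: tensor2 \<Rightarrow> tensor2)"
  by (intro linear_conv_bounded_linear[THEN iffD1] linearI) (auto simp: transpose_def vec_eq_iff)

lemma pd_antisym:
  assumes "F differentiable (at p)" "\<And>p. F p \<in> antisym_tensors"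
  shows "transpose (pd F a p) = - pd F a p"
proof -
  have "pd (\<lambda>p. transpose (F p)) a p = transpose (pd F a p)"
    by (rule pd_bounded_linear[OF bounded_linear_transpose assms(1)])
  moreover have "pd (\<lambda>p. - F p) a p = - pd F a p"
    by (rule pd_bounded_linear[OF _ assms(1)]) (rule bounded_linear_minus[OF bounded_linear_ident])
  moreover have "(\<lambda>p. transpose (F p)) = (\<lambda>p. - F p)"
    using assms(2) by (auto simp: antisym_tensors_def)
  ultimately show ?thesis by simp
qed

lemma antisym_component: "transpose (\<phi> :: tensor2) = - \<phi> \<Longrightarrow> \<phi> $ a $ b = - \<phi> $ b $ a"
  by (drule arg_cong[of _ _ "\<lambda>M. M $ b $ a"]) (simp add: transpose_def)

lemma alt3_idem: "alt3 (alt3 T) = alt3 T"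
  by (auto simp: alt3_def vec_eq_iff field_simps)

lemma alt3_sum: "(\<Sum>m\<in>A. alt3 (f m)) = alt3 (\<Sum>m\<in>A. f m)"
  by (simp add: alt3_def vec_eq_iff sum.distrib sum_subtractf sum_divide_distrib[symmetric])

lemma sum_outer_axis: "(\<Sum>m\<in>UNIV. outer (axis m 1) (f m)) = (\<chi> m. f m)"
proof -
  have "(\<Sum>m\<in>UNIV. (axis m 1 :: vec4) $ a * f m $ b $ c) = f a $ b $ c" for a b c
    by (subst sum.remove[of _ a]) (auto simp: axis_def intro!: sum.neutral)
  then show ?thesis
    by (simp add: outer_def vec_eq_iff)
qed

lemma gordon_up_sym: "gordon_up n \<xi> $ a $ b = gordon_up n \<xi> $ b $ a"
  by (simp add: gordon_up_def eta_sym[of a b])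

lemma sum_maxwell_k:
  assumes "\<And>m. transpose (f m) = - f m"
  shows "(\<Sum>m\<in>UNIV. maxwell_k n \<xi> x (s, t) (axis m 1) (f m)) =
    s \<bullet> (\<chi> b. \<Sum>a\<in>UNIV. \<Sum>m\<in>UNIV. gordon_up n \<xi> $ a $ m * f a $ m $ b) + t \<bullet> alt3 (\<chi> m. f m)"
proof -
  have 1: "- (f m *v (gordon_up n \<xi> *v axis m 1)) $ b
      = (\<Sum>l\<in>UNIV. gordon_up n \<xi> $ m $ l * f m $ l $ b)" for m b
  proof -
    have "- (f m *v (gordon_up n \<xi> *v axis m 1)) $ b
      = - (\<Sum>l\<in>UNIV. f m $ b $ l * gordon_up n \<xi> $ l $ m)"
      by (simp add: matrix_vector_mult_basis column_def) (simp add: matrix_vector_mult_def)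
    also have "\<dots> = (\<Sum>l\<in>UNIV. gordon_up n \<xi> $ m $ l * f m $ l $ b)"
      unfolding sum_negf[symmetric]
      by (rule sum.cong)
        (auto simp: antisym_component[OF assms, of m b] gordon_up_sym[of n \<xi> m])
    finally show ?thesis .
  qed
  have "(\<Sum>m\<in>UNIV. maxwell_k n \<xi> x (s, t) (axis m 1) (f m)) =
      s \<bullet> (\<Sum>m\<in>UNIV. - (f m *v (gordon_up n \<xi> *v axis m 1)))
      + t \<bullet> (\<Sum>m\<in>UNIV. alt3 (outer (axis m 1) (f m)))"
    by (simp only: maxwell_k_def sum.distrib inner_sum_right fst_conv snd_conv)
  also have "(\<Sum>m\<in>UNIV. - (f m *v (gordon_up n \<xi> *v axis m 1)))
      = (\<chi> b. \<Sum>a\<in>UNIV. \<Sum>m\<in>UNIV. gordon_up n \<xi> $ a $ m * f a $ m $ b)"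
    using 1 by (simp add: vec_eq_iff)
  finally show ?thesis
    by (simp add: alt3_sum sum_outer_axis)
qed

lemma first_order_maxwell_iff_solves_system:
  assumes "\<And>p. F differentiable (at p)" "\<And>p. F p \<in> antisym_tensors"
  shows "first_order_maxwell n \<xi> F \<longleftrightarrow> solves_system (maxwell_k n \<xi>) F"
proof -
  define Q where "Q p = (\<chi> b. \<Sum>a\<in>UNIV. \<Sum>m\<in>UNIV. gordon_up n \<xi> $ a $ m * pd F a p $ m $ b)" for p
  define R where "R p = alt3 (\<chi> m. pd F m p)" for p
  have "solves_system (maxwell_k n \<xi>) F \<longleftrightarrow>
      (\<forall>p s t. t = alt3 t \<longrightarrow> s \<bullet> Q p + t \<bullet> R p = 0)"
    unfolding solves_system_def Q_def R_def equation_space_def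
    by (auto simp: sum_maxwell_k pd_antisym[OF assms])
  also have "\<dots> \<longleftrightarrow> (\<forall>p. Q p = 0 \<and> R p = 0)"
  proof (intro iffI allI)
    fix p assume *: "\<forall>p s t. t = alt3 t \<longrightarrow> s \<bullet> Q p + t \<bullet> R p = 0"
    have "Q p \<bullet> Q p + 0 \<bullet> R p = 0"
      by (rule *[rule_format]) (simp add: alt3_def vec_eq_iff)
    moreover have "0 \<bullet> Q p + R p \<bullet> R p = 0"
      by (rule *[rule_format]) (simp add: R_def alt3_idem)
    ultimately show "Q p = 0 \<and> R p = 0" by simp
  qed simp
  finally show ?thesis
    by (auto simp: first_order_maxwell_def Q_def R_def vec_eq_iff)
qed

lemma levi_civita_swap: "levi_civita a c b d = - levi_civita a b c d"
proof -
  let ?r = "\<lambda>a b c d (i::4). if i = 0 then a else if i = 1 then b else if i = 2 then c else d :: 4"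
  let ?p = "Transposition.transpose (1::4) 2"
  have "(\<chi> i. axis (?r a c b d i) 1 :: tensor2) = (\<chi> i. (\<chi> i. axis (?r a b c d i) 1 :: tensor2) $ ?p i)"
    by (auto simp: vec_eq_iff Transposition.transpose_def)
  moreover have "?p permutes (UNIV :: 4 set)"
    by (rule permutes_swap_id) auto
  moreover have "sign ?p = - 1"
    by (simp add: sign_swap_id)
  ultimately show ?thesis
    using det_permute_rows[of ?p "\<chi> i. axis (?r a b c d i) 1 :: tensor2"]
    unfolding levi_civita_def by simp
qed

lemma levi_civita_swap_outer: "levi_civita b a c d = - levi_civita a b c d"
proof -
  let ?r = "\<lambda>a b c d (i::4). if i = 0 then a else if i = 1 then b else if i = 2 then c else d :: 4"
  let ?p = "Transposition.transpose (0::4) 1"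
  have "(\<chi> i. axis (?r b a c d i) 1 :: tensor2) = (\<chi> i. (\<chi> i. axis (?r a b c d i) 1 :: tensor2) $ ?p i)"
    by (auto simp: vec_eq_iff Transposition.transpose_def)
  moreover have "?p permutes (UNIV :: 4 set)"
    by (rule permutes_swap_id) auto
  moreover have "sign ?p = - 1"
    by (simp add: sign_swap_id)
  ultimately show ?thesis
    using det_permute_rows[of ?p "\<chi> i. axis (?r a b c d i) 1 :: tensor2"]
    unfolding levi_civita_def by simp
qed

lemma field_tensor_antisym: "field_tensor \<xi> E B \<in> antisym_tensors"
proof -
  define X where "X a b =
    (\<Sum>c\<in>UNIV. \<Sum>d\<in>UNIV. levi_civita a b c d * (eta *v (eta *v \<xi>)) $ c * (eta *v B) $ d)" for a b
  have X: "X b a + X a b = 0" for a b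
    unfolding X_def sum.distrib[symmetric]
    by (intro sum.neutral ballI) (subst levi_civita_swap_outer, simp)
  have "field_tensor \<xi> E B $ b $ a + field_tensor \<xi> E B $ a $ b = 0" for a b
    using X[of b a] by (simp add: field_tensor_def X_def)
  then show ?thesis
    by (simp add: antisym_tensors_def transpose_def vec_eq_iff eq_neg_iff_add_eq_0)
qed

lemma field_tensor_velocity:
  assumes "\<xi> \<bullet> (eta *v \<xi>) = 1" "E \<bullet> \<xi> = 0"
  shows "field_tensor \<xi> E B *v \<xi> = E"
proof -
  define y where "y = eta *v B"
  have "(field_tensor \<xi> E B *v \<xi>) $ a = E $ a" for a
  proof -
    define S where "S = (\<Sum>b\<in>UNIV. \<Sum>c\<in>UNIV. \<Sum>d\<in>UNIV. levi_civita a b c d * \<xi> $ c * y $ d * \<xi> $ b)"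
    have "S = (\<Sum>b\<in>UNIV. \<Sum>c\<in>UNIV. \<Sum>d\<in>UNIV. levi_civita a c b d * \<xi> $ b * y $ d * \<xi> $ c)"
      unfolding S_def by (rule sum.swap)
    also have "\<dots> = - S"
      unfolding S_def sum_negf[symmetric]
      by (intro sum.cong refl) (subst levi_civita_swap, simp)
    finally have S: "S = 0" by simp
    have "(field_tensor \<xi> E B *v \<xi>) $ a =
        (\<Sum>b\<in>UNIV. E $ a * (\<xi> $ b * (eta *v \<xi>) $ b) - (eta *v \<xi>) $ a * (E $ b * \<xi> $ b)
          + (\<Sum>c\<in>UNIV. \<Sum>d\<in>UNIV. levi_civita a b c d * \<xi> $ c * y $ d * \<xi> $ b))"
      unfolding matrix_vector_mult_def[of "field_tensor \<xi> E B"]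
      by (simp add: field_tensor_def eta_mult_eta y_def sum_distrib_left sum_distrib_right algebra_simps)
    also have "\<dots> = E $ a * (\<xi> \<bullet> (eta *v \<xi>)) - (eta *v \<xi>) $ a * (E \<bullet> \<xi>) + S"
      by (simp add: sum.distrib sum_subtractf sum_distrib_left[symmetric] inner_vec_def S_def)
    finally show ?thesis
      by (simp add: S assms)
  qed
  then show ?thesis by (simp add: vec_eq_iff)
qed

text \<open>\<open>(2 (1 - n\<^sup>2) \<xi>\<^bsub>[a\<^esub> F\<^bsub>b]m\<^esub> \<xi>\<^sup>m + F\<^sub>a\<^sub>b) / \<mu>\<close>\<close>

definition response_tensor :: "real \<Rightarrow> real \<Rightarrow> vec4 \<Rightarrow> tensor2 \<Rightarrow> tensor2" where
  "response_tensor n \<mu> \<xi> F =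
     (\<chi> a b. ((1 - n\<^sup>2) * ((eta *v \<xi>) $ a * (F *v \<xi>) $ b - (eta *v \<xi>) $ b * (F *v \<xi>) $ a)
              + F $ a $ b) / \<mu>)"

lemma field_tensor_response:
  assumes "\<epsilon> > 0" "\<mu> > 0" "\<xi> \<bullet> (eta *v \<xi>) = 1" "E \<bullet> \<xi> = 0"
  shows "field_tensor \<xi> (\<epsilon> *\<^sub>R E) ((1 / \<mu>) *\<^sub>R B)
    = response_tensor (sqrt (\<epsilon> * \<mu>)) \<mu> \<xi> (field_tensor \<xi> E B)"
proof -
  have n2: "(sqrt (\<epsilon> * \<mu>))\<^sup>2 = \<epsilon> * \<mu>"
    using assms by simp
  define X where "X a b = (\<Sum>c\<in>UNIV. \<Sum>d\<in>UNIV. levi_civita a b c d * \<xi> $ c * (eta *v B) $ d)" for a b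
  have X: "(\<Sum>c\<in>UNIV. \<Sum>d\<in>UNIV. levi_civita a b c d * \<xi> $ c * (eta *v ((1 / \<mu>) *\<^sub>R B)) $ d)
      = X a b / \<mu>" for a b
    by (simp add: X_def matrix_vector_mult_scaleR sum_divide_distrib)
  have "\<epsilon> * e * w' - \<epsilon> * e' * w'' + x / \<mu> =
      ((1 - \<epsilon> * \<mu>) * (w'' * e' - w' * e) + (e * w' - e' * w'' + x)) / \<mu>" for e e' w' w'' x
    using assms(2) by (simp add: field_simps)
  then show ?thesis
    unfolding response_tensor_def field_tensor_velocity[OF assms(3,4)] n2
    by (simp add: field_tensor_def vec_eq_iff eta_mult_eta X X_def[symmetric])
qed

lemma linear_response: "linear (response_tensor n \<mu> \<xi>)"
  by (rule linearI)
    (auto simp: response_tensor_def vec_eq_iff matrix_vector_mult_add_rdistrib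
      scaleR_matrix_vector_assoc[symmetric] algebra_simps add_divide_distrib diff_divide_distrib)

lemma linear_eta_conj: "linear (\<lambda>P. eta ** P ** transpose eta)"
proof (rule linearI)
  show "eta ** (P + Q) ** transpose eta = eta ** P ** transpose eta + eta ** Q ** transpose eta" for P Q
    unfolding transpose_eta
    by (simp add: vec_eq_iff matrix_matrix_mult_def distrib_left distrib_right sum.distrib)
  show "eta ** (c *\<^sub>R P) ** transpose eta = c *\<^sub>R (eta ** P ** transpose eta)" for c P
    unfolding transpose_eta
    by (simp add: vec_eq_iff matrix_matrix_mult_def sum_distrib_left[symmetric] mult.left_commute mult.assoc)
qed

lemma linear_field_tensor: "linear (\<lambda>(E, B). field_tensor \<xi> E B)"
proof (rule linearI)
  show "(case p + q of (E, B) \<Rightarrow> field_tensor \<xi> E B) =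
      (case p of (E, B) \<Rightarrow> field_tensor \<xi> E B) + (case q of (E, B) \<Rightarrow> field_tensor \<xi> E B)" for p q
    by (cases p; cases q) (simp add: field_tensor_def vec_eq_iff matrix_vector_right_distrib
        distrib_left distrib_right sum.distrib)
  show "(case c *\<^sub>R p of (E, B) \<Rightarrow> field_tensor \<xi> E B) =
      c *\<^sub>R (case p of (E, B) \<Rightarrow> field_tensor \<xi> E B)" for c p
    by (cases p) (simp add: field_tensor_def vec_eq_iff matrix_vector_mult_scaleR
        sum_distrib_left distrib_left right_diff_distrib mult.left_commute)
qed

lemma divergence_response:
  assumes "\<mu> > 0" "n > 0" "\<xi> \<bullet> (eta *v \<xi>) = 1" "\<And>a. transpose (\<Phi> a) = - \<Phi> a"
  shows "(\<forall>b. (\<Sum>a\<in>UNIV. (eta ** response_tensor n \<mu> \<xi> (\<Phi> a) ** transpose eta) $ a $ b) = 0) \<longleftrightarrow>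
         (\<forall>b. (\<Sum>a\<in>UNIV. \<Sum>m\<in>UNIV. gordon_up n \<xi> $ a $ m * \<Phi> a $ m $ b) = 0)"
proof -
  define w where "w = eta *v \<xi>"
  define d where "d = 1 - n\<^sup>2"
  define J where "J = (\<chi> b. \<Sum>a\<in>UNIV. \<Sum>m\<in>UNIV. eta $ a $ m * \<Phi> a $ m $ b)"
  define K where "K = (\<Sum>a\<in>UNIV. \<xi> $ a *\<^sub>R (\<Phi> a *v \<xi>))"
  define S where "S = J \<bullet> \<xi>"
  define D where "D = (\<chi> b. \<Sum>a\<in>UNIV. (eta ** response_tensor n \<mu> \<xi> (\<Phi> a)) $ a $ b)"
  have skew: "(\<Phi> a *v \<xi>) \<bullet> \<xi> = 0" for a
  proof -
    have "(\<Phi> a *v \<xi>) \<bullet> \<xi> = \<xi> \<bullet> (transpose (\<Phi> a) *v \<xi>)"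
      using dot_lmul_matrix[of \<xi> "\<Phi> a" \<xi>] by (simp add: inner_commute)
    also have "\<dots> = - ((\<Phi> a *v \<xi>) \<bullet> \<xi>)"
      using matrix_vector_mult_diff_rdistrib[of 0 "\<Phi> a" \<xi>]
      by (simp add: assms(4) inner_commute del: transpose_matrix_vector)
    finally show ?thesis by simp
  qed
  have K\<xi>: "K \<bullet> \<xi> = 0"
    by (simp add: K_def inner_sum_left skew)
  have w\<xi>: "w \<bullet> \<xi> = 1"
    using assms(3) by (simp add: w_def inner_commute)
  have ew: "eta *v w = \<xi>"
    by (simp add: w_def eta_mult_eta)
  have SS: "(\<Sum>a\<in>UNIV. \<Sum>m\<in>UNIV. eta $ a $ m * (\<Phi> a *v \<xi>) $ m) = S"
  proof -
    have "S = (\<Sum>b\<in>UNIV. \<Sum>a\<in>UNIV. \<Sum>m\<in>UNIV. eta $ a $ m * \<Phi> a $ m $ b * \<xi> $ b)"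
      by (simp add: S_def J_def inner_vec_def sum_distrib_right)
    also have "\<dots> = (\<Sum>a\<in>UNIV. \<Sum>m\<in>UNIV. \<Sum>b\<in>UNIV. eta $ a $ m * \<Phi> a $ m $ b * \<xi> $ b)"
      by (subst sum.swap) (intro sum.cong refl sum.swap)
    finally show ?thesis
      by (simp add: matrix_vector_mult_def sum_distrib_left mult.assoc)
  qed
  have Q: "(\<Sum>a\<in>UNIV. \<Sum>m\<in>UNIV. gordon_up n \<xi> $ a $ m * \<Phi> a $ m $ b) = (J + d *\<^sub>R K) $ b" for b
  proof -
    have "(\<Phi> a *v \<xi>) $ b = - (\<Sum>m\<in>UNIV. \<xi> $ m * \<Phi> a $ m $ b)" for a
      unfolding matrix_vector_mult_def sum_negf[symmetric]
      by (auto simp: antisym_component[OF assms(4), of a b] intro!: sum.cong)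
    then show ?thesis
      by (simp add: gordon_up_def J_def K_def d_def[symmetric] sum_distrib_left
          sum_subtractf algebra_simps sum_negf)
  qed
  have Db: "D = (1 / \<mu>) *\<^sub>R (J + d *\<^sub>R (K - S *\<^sub>R w))"
  proof -
    have "D $ b = (J $ b + d * (K $ b - S * w $ b)) / \<mu>" for b
    proof -
      have "D $ b = (\<Sum>a\<in>UNIV. \<Sum>m\<in>UNIV. eta $ a $ m *
          ((d * (w $ m * (\<Phi> a *v \<xi>) $ b - w $ b * (\<Phi> a *v \<xi>) $ m) + \<Phi> a $ m $ b) / \<mu>))"
        by (simp add: D_def matrix_matrix_mult_def response_tensor_def w_def d_def)
      also have "\<dots> = (\<Sum>a\<in>UNIV. \<Sum>m\<in>UNIV. (eta $ a $ m * \<Phi> a $ m $ b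
          + (d * (\<Phi> a *v \<xi>) $ b) * (eta $ a $ m * w $ m)
          - (d * w $ b) * (eta $ a $ m * (\<Phi> a *v \<xi>) $ m)) / \<mu>)"
        by (intro sum.cong refl) (simp add: algebra_simps)
      also have "\<dots> = (J $ b + (\<Sum>a\<in>UNIV. (d * (\<Phi> a *v \<xi>) $ b) * (\<Sum>m\<in>UNIV. eta $ a $ m * w $ m))
          - (d * w $ b) * (\<Sum>a\<in>UNIV. \<Sum>m\<in>UNIV. eta $ a $ m * (\<Phi> a *v \<xi>) $ m)) / \<mu>"
        by (simp add: sum_divide_distrib[symmetric] sum.distrib sum_subtractf
            sum_distrib_left[symmetric] J_def)
      also have "(\<Sum>a\<in>UNIV. (d * (\<Phi> a *v \<xi>) $ b) * (\<Sum>m\<in>UNIV. eta $ a $ m * w $ m)) = d * K $ b"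
        unfolding eta_vec ew by (simp add: K_def sum_distrib_left mult.commute mult.left_commute)
      finally show ?thesis
        by (simp add: SS algebra_simps)
    qed
    then show ?thesis by (simp add: vec_eq_iff)
  qed
  have "(\<forall>b. (\<Sum>a\<in>UNIV. (eta ** response_tensor n \<mu> \<xi> (\<Phi> a) ** transpose eta) $ a $ b) = 0)
      \<longleftrightarrow> eta *v D = 0"
  proof -
    have "(\<Sum>a\<in>UNIV. (M a ** transpose eta) $ a $ b) = (eta *v (\<chi> b. \<Sum>a\<in>UNIV. M a $ a $ b)) $ b"
      for M :: "4 \<Rightarrow> tensor2" and b
      unfolding transpose_eta matrix_matrix_mult_def matrix_vector_mult_def
      by (simp add: sum_distrib_left, subst sum.swap)
        (simp add: eta_sym[of b] mult.commute)
    then show ?thesis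
      by (simp add: D_def vec_eq_iff)
  qed
  also have "\<dots> \<longleftrightarrow> D = 0"
    by (metis eta_mult_eta matrix_vector_mult_0_right)
  also have "\<dots> \<longleftrightarrow> J + d *\<^sub>R (K - S *\<^sub>R w) = 0"
    using assms(1) by (simp add: Db)
  also have "\<dots> \<longleftrightarrow> J + d *\<^sub>R K = 0"
  proof -
    have "S = 0" if "J + d *\<^sub>R (K - S *\<^sub>R w) = 0"
    proof -
      have "(J + d *\<^sub>R (K - S *\<^sub>R w)) \<bullet> \<xi> = n\<^sup>2 * S"
        by (simp add: inner_add_left inner_diff_left K\<xi> w\<xi> S_def[symmetric] d_def algebra_simps)
      with that assms(2) show ?thesis by simp
    qed
    moreover have "S = 0" if "J + d *\<^sub>R K = 0"
    proof -
      have "(J + d *\<^sub>R K) \<bullet> \<xi> = S"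
        by (simp add: inner_add_left K\<xi> S_def[symmetric])
      with that show ?thesis by simp
    qed
    ultimately show ?thesis by auto
  qed
  finally show ?thesis
    by (simp add: Q vec_eq_iff)
qed

lemma macroscopic_maxwell_iff_first_order_maxwell:
  assumes "\<epsilon> > 0" "\<mu> > 0" "\<xi> \<bullet> (eta *v \<xi>) = 1"
    and "\<And>p. E differentiable (at p)" "\<And>p. B differentiable (at p)"
    and "\<And>p. E p \<bullet> \<xi> = 0"
  shows "macroscopic_maxwell \<epsilon> \<mu> \<xi> E B \<longleftrightarrow>
         first_order_maxwell (sqrt (\<epsilon> * \<mu>)) \<xi> (\<lambda>p. field_tensor \<xi> (E p) (B p))"
proof -
  define n where "n = sqrt (\<epsilon> * \<mu>)"
  have n: "n > 0" using assms by (simp add: n_def)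
  define F where "F = (\<lambda>p. field_tensor \<xi> (E p) (B p))"
  let ?L = "\<lambda>F. eta ** response_tensor n \<mu> \<xi> F ** transpose eta"
  have "bounded_linear (\<lambda>(E, B). field_tensor \<xi> E B)"
    using linear_field_tensor by (simp add: linear_conv_bounded_linear)
  then have "(\<lambda>(E, B). field_tensor \<xi> E B) differentiable (at q)" for q
    by (rule bounded_linear_imp_differentiable)
  moreover have "(\<lambda>p. (E p, B p)) differentiable (at p)" for p
    using assms(4,5)[of p] unfolding differentiable_def by (blast intro: has_derivative_Pair)
  ultimately have dF: "F differentiable (at p)" for p
    using differentiable_compose[of "\<lambda>(E, B). field_tensor \<xi> E B" "\<lambda>p. (E p, B p)" p UNIV]
    by (simp add: F_def)
  have anti: "F p \<in> antisym_tensors" for p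
    by (simp add: F_def field_tensor_antisym)
  have "linear ?L"
    using linear_compose[OF linear_response[of n \<mu> \<xi>] linear_eta_conj] by (simp add: o_def)
  then have bl: "bounded_linear ?L"
    by (simp add: linear_conv_bounded_linear)
  have pdP: "pd (\<lambda>p. eta ** field_tensor \<xi> (\<epsilon> *\<^sub>R E p) ((1 / \<mu>) *\<^sub>R B p) ** transpose eta) a p
      = ?L (pd F a p)" for a p
    using pd_bounded_linear[OF bl dF, of a p]
    by (simp only: field_tensor_response[OF assms(1-3,6)] F_def n_def)
  show ?thesis
    unfolding macroscopic_maxwell_def first_order_maxwell_def Let_def pdP n_def[symmetric]
      F_def[symmetric]
    using divergence_response[OF assms(2) n assms(3) pd_antisym[OF dF anti]] by simp
qed

end

theory Submission
  imports Defs
begin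

text \<open>
  In a frame that is orthonormal for Gordon's metric, with timelike leg along \<open>\<zeta>\<close>, the contraction of
  \<open>h\<close>, \<open>k\<close> and a covector \<open>m\<close> is the Minkowski energy-momentum expression
  \<open>m\<^sub>0 (|E|\<^sup>2 + |B|\<^sup>2) - 2 m \<cdot> (E \<times> B)\<close>, positive definite exactly for
  \<open>m\<^sub>0 > |m|\<close>. The causal cone is then the dual of the cone of these covectors. It is a convex set,
  hence (without \<open>0\<close>) a connected component of the nonzero causal vectors, so cones of the two metrics
  compare through connectedness as soon as the nonzero causal vectors of one are timelike for the other;
  this in turn is read off the sign of \<open>1 - n\<^sup>2\<close> in Gordon's metric. Since \<open>eta\<close> is Gordon's
  metric for \<open>n = 1\<close>, the same frames serve for both.
\<close>

section \<open>Minkowski space in components\<close>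

text \<open>In type \<open>4\<close> the numeral 4 equals 0, so the enumeration 1, 2, 3, 4 is
  rearranged to start with the time coordinate.\<close>

lemma sum_UNIV_4: "(\<Sum>i\<in>UNIV. f i) = f 0 + f 1 + f 2 + f (3 :: 4)"
  for f :: "4 \<Rightarrow> 'a::comm_monoid_add"
proof -
  have "(4::4) = 0" by simp
  then show ?thesis using sum_4[of f] by (simp only: ac_simps)
qed

lemma forall_UNIV_4: "(\<forall>i. P i) \<longleftrightarrow> P 0 \<and> P 1 \<and> P 2 \<and> P (3 :: 4)"
proof -
  have "(4::4) = 0" by simp
  then show ?thesis using forall_4[of P] by metis
qed

lemma eta_vec_component: "(eta *v x) $ a = (if a = 0 then x $ 0 else - x $ a)"
proof -
  have "(\<Sum>k\<in>UNIV - {a}. eta $ a $ k * x $ k) = 0"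
    by (rule sum.neutral) (auto simp: eta_def)
  then show ?thesis
    unfolding matrix_vector_mult_def by (simp add: sum.remove[of UNIV a]) (simp add: eta_def)
qed

lemma inner_eta:
  "x \<bullet> (eta *v y) = x $ 0 * y $ 0 - x $ 1 * y $ 1 - x $ 2 * y $ 2 - x $ 3 * y $ 3"
  by (simp add: inner_vec_def sum_UNIV_4 eta_vec_component)

lemma inner_vec4: "(x :: vec4) \<bullet> y = x $ 0 * y $ 0 + x $ 1 * y $ 1 + x $ 2 * y $ 2 + x $ 3 * y $ 3"
  by (simp add: inner_vec_def sum_UNIV_4)

lemma causal_alt: "causal g v \<longleftrightarrow> v \<bullet> (g *v v) \<ge> 0"
  by (auto simp: causal_def timelike_def null_vector_def)

lemma inner_matrix_vector: "x \<bullet> (M *v y) = (transpose M *v x) \<bullet> y" for M :: tensor2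
  by (simp add: dot_lmul_matrix)

text \<open>Lagrange's identity: the difference of the two sides is the squared length of the cross
  product.\<close>

lemma cauchy_schwarz_3:
  fixes a b c x y z :: real
  shows "(a * x + b * y + c * z)\<^sup>2 \<le> (a\<^sup>2 + b\<^sup>2 + c\<^sup>2) * (x\<^sup>2 + y\<^sup>2 + z\<^sup>2)"
proof -
  have "(a\<^sup>2 + b\<^sup>2 + c\<^sup>2) * (x\<^sup>2 + y\<^sup>2 + z\<^sup>2) - (a * x + b * y + c * z)\<^sup>2
      = (a * y - b * x)\<^sup>2 + (b * z - c * y)\<^sup>2 + (a * z - c * x)\<^sup>2"
    by (simp add: power2_eq_square algebra_simps)
  then show ?thesis by (metis add_nonneg_nonneg diff_ge_0_iff_ge zero_le_power2)
qed

text \<open>Self-duality of the Minkowski cone. Causal vectors pair nonnegatively by Cauchy-Schwarz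
  on the spatial parts; conversely, timelike covectors approaching the null one with spatial part
  opposite to that of \<open>v\<close> force \<open>v $ 0\<close> to be at least the spatial length
  \<open>r\<close>.\<close>

lemma eta_dual_cone:
  "(\<forall>m. timelike eta m \<and> m $ 0 > 0 \<longrightarrow> v \<bullet> m \<ge> 0) \<longleftrightarrow> causal eta v \<and> v $ 0 \<ge> 0"
proof (intro iffI allI impI)
  fix m assume v: "causal eta v \<and> v $ 0 \<ge> 0" and m: "timelike eta m \<and> m $ 0 > 0"
  let ?p = "v $ 1 * m $ 1 + v $ 2 * m $ 2 + v $ 3 * m $ 3"
  have "?p\<^sup>2 \<le> ((v $ 1)\<^sup>2 + (v $ 2)\<^sup>2 + (v $ 3)\<^sup>2) * ((m $ 1)\<^sup>2 + (m $ 2)\<^sup>2 + (m $ 3)\<^sup>2)"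
    by (rule cauchy_schwarz_3)
  also have "\<dots> \<le> (v $ 0)\<^sup>2 * (m $ 0)\<^sup>2"
  proof (rule mult_mono)
    show "(v $ 1)\<^sup>2 + (v $ 2)\<^sup>2 + (v $ 3)\<^sup>2 \<le> (v $ 0)\<^sup>2"
      using v by (simp add: causal_alt inner_eta power2_eq_square)
    show "(m $ 1)\<^sup>2 + (m $ 2)\<^sup>2 + (m $ 3)\<^sup>2 \<le> (m $ 0)\<^sup>2"
      using m by (simp add: timelike_def inner_eta power2_eq_square)
  qed auto
  finally have "?p\<^sup>2 \<le> (v $ 0 * m $ 0)\<^sup>2"
    by (simp add: power_mult_distrib)
  then have "\<bar>?p\<bar> \<le> v $ 0 * m $ 0"
    using v m abs_le_square_iff[of ?p "v $ 0 * m $ 0"] by simp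
  then show "v \<bullet> m \<ge> 0"
    by (simp add: inner_vec4)
next
  assume *: "\<forall>m. timelike eta m \<and> m $ 0 > 0 \<longrightarrow> v \<bullet> m \<ge> 0"
  have "timelike eta (axis 0 1)" "(axis 0 1 :: vec4) $ 0 > 0"
    by (auto simp: timelike_def inner_eta axis_def)
  with * have "v \<bullet> axis 0 1 \<ge> 0"
    by blast
  then have v0: "v $ 0 \<ge> 0"
    by (simp add: inner_axis)
  define r where "r = sqrt ((v $ 1)\<^sup>2 + (v $ 2)\<^sup>2 + (v $ 3)\<^sup>2)"
  have r: "r \<ge> 0" "r\<^sup>2 = (v $ 1)\<^sup>2 + (v $ 2)\<^sup>2 + (v $ 3)\<^sup>2"
    by (auto simp: r_def)
  have approx: "v $ 0 * (r + d) \<ge> r\<^sup>2" if "d > 0" for d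
  proof -
    \<comment> \<open>Spatially opposite to \<open>v\<close> and timelike for every
      \<open>d > 0\<close>; it becomes null as \<open>d\<close> tends to 0.\<close>
    define m :: vec4 where "m = (\<chi> i. if i = 0 then r + d else - v $ i)"
    have "r * r < (r + d) * (r + d)"
      using r that by (intro mult_strict_mono) auto
    then have "timelike eta m"
      using r by (simp add: m_def timelike_def inner_eta power2_eq_square)
    moreover have "m $ 0 > 0"
      using r that by (simp add: m_def)
    ultimately have "v \<bullet> m \<ge> 0" using * by blast
    then show ?thesis
      using r by (simp add: inner_vec4 m_def power2_eq_square)
  qed
  \<comment> \<open>The choice \<open>d = e / v $ 0\<close> turns the excess into \<open>e\<close>;
    if \<open>v $ 0 = 0\<close>, the bound for \<open>d = 1\<close> already gives
    \<open>r = 0\<close>.\<close>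
  have "v $ 0 * r + e \<ge> r\<^sup>2" if "e > 0" for e
    using that v0 approx[of "e / v $ 0"] approx[of 1]
    by (cases "v $ 0 = 0") (auto simp: distrib_left)
  then have "r\<^sup>2 \<le> v $ 0 * r"
    by (rule field_le_epsilon)
  then have "r * r \<le> v $ 0 * r"
    by (simp add: power2_eq_square)
  then have "v $ 0 \<ge> r"
    using r v0 by (cases "r = 0") auto
  then have "(v $ 0)\<^sup>2 \<ge> r\<^sup>2"
    using r by (intro power_mono) auto
  then show "causal eta v \<and> v $ 0 \<ge> 0"
    using r v0 by (simp add: causal_alt inner_eta power2_eq_square)
qed

text \<open>Without a time component the norm is minus a sum of squares. This is what keeps the two
  lobes apart.\<close>

lemma eta_causal_time_nonzero:
  assumes "causal eta v" "v \<noteq> 0"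
  shows "v $ 0 \<noteq> 0"
proof
  assume "v $ 0 = 0"
  with assms(1) have "(v $ 1)\<^sup>2 + (v $ 2)\<^sup>2 + (v $ 3)\<^sup>2 \<le> 0"
    by (simp add: causal_alt inner_eta power2_eq_square)
  then have "(v $ 1)\<^sup>2 = 0" "(v $ 2)\<^sup>2 = 0" "(v $ 3)\<^sup>2 = 0"
    using zero_le_power2[of "v $ 1"] zero_le_power2[of "v $ 2"] zero_le_power2[of "v $ 3"]
    by linarith+
  with \<open>v $ 0 = 0\<close> assms(2) show False
    by (simp add: vec_eq_iff forall_UNIV_4)
qed

section \<open>The quadratic form of the system\<close>

text \<open>The symmetric form \<open>h\<^sup>A\<^bsub>\<beta>'\<^esub> k\<^sub>A\<^sup>m\<^bsub>\<alpha>'\<^esub> n\<^sub>m\<close>, with \<open>G\<close> the inverse metric and \<open>z = \<zeta>\<close>.\<close>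

definition maxwell_form :: "tensor2 \<Rightarrow> vec4 \<Rightarrow> vec4 \<Rightarrow> tensor2 \<Rightarrow> tensor2 \<Rightarrow> real" where
  "maxwell_form G z m \<phi> \<psi> =
     (z \<bullet> m) * ((G ** \<phi> ** transpose G) \<bullet> \<psi>) / 2
     - (G *v (\<phi> *v z)) \<bullet> (\<psi> *v (G *v m)) - (\<phi> *v (G *v m)) \<bullet> (G *v (\<psi> *v z))"

text \<open>For antisymmetric factors each alternation is a cyclic sum of three terms. Up to cyclic
  relabelling their nine products reduce to three: one gives the full contraction, the other two
  both give the mixed one.\<close>

lemma inner_alt3_outer:
  fixes X \<psi> :: tensor2
  assumes "transpose X = - X" "transpose \<psi> = - \<psi>"
  shows "alt3 (outer z X) \<bullet> alt3 (outer m \<psi>)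
    = ((z \<bullet> m) * (X \<bullet> \<psi>) - 2 * ((X *v m) \<bullet> (\<psi> *v z))) / 3"
proof -
  have alt: "alt3 (outer u Y) $ a $ b $ c = (u $ a * Y $ b $ c + u $ b * Y $ c $ a + u $ c * Y $ a $ b) / 3"
    if "transpose Y = - Y" for u Y a b c
    using antisym_component[OF that, of b a] antisym_component[OF that, of c b]
      antisym_component[OF that, of a c]
    by (simp add: alt3_def outer_def)
  define p where "p a b c = z $ a * X $ b $ c" for a b c
  define q where "q a b c = m $ a * \<psi> $ b $ c" for a b c
  have cyc: "(\<Sum>a\<in>UNIV. \<Sum>b\<in>UNIV. \<Sum>c\<in>UNIV. f b c a) = (\<Sum>a\<in>UNIV. \<Sum>b\<in>UNIV. \<Sum>c\<in>UNIV. f a b c)"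
    for f :: "4 \<Rightarrow> 4 \<Rightarrow> 4 \<Rightarrow> real"
  proof -
    have "(\<Sum>a\<in>UNIV. \<Sum>b\<in>UNIV. \<Sum>c\<in>UNIV. f b c a) = (\<Sum>b\<in>UNIV. \<Sum>a\<in>UNIV. \<Sum>c\<in>UNIV. f b c a)"
      by (rule sum.swap)
    also have "\<dots> = (\<Sum>b\<in>UNIV. \<Sum>c\<in>UNIV. \<Sum>a\<in>UNIV. f b c a)"
      by (intro sum.cong refl sum.swap)
    finally show ?thesis .
  qed
  let ?q = "\<lambda>a b c. q a b c + q b c a + q c a b"
  let ?T = "\<Sum>a\<in>UNIV. \<Sum>b\<in>UNIV. \<Sum>c\<in>UNIV. p a b c * ?q a b c"
  have "alt3 (outer z X) \<bullet> alt3 (outer m \<psi>) =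
      (\<Sum>a\<in>UNIV. \<Sum>b\<in>UNIV. \<Sum>c\<in>UNIV. (p a b c + p b c a + p c a b) * ?q a b c) / 9"
    by (simp add: inner_vec_def alt assms p_def q_def sum_divide_distrib)
  \<comment> \<open>\<open>?q\<close> is invariant under cyclic shifts, so each shift of
    \<open>p\<close> contributes the same sum \<open>?T\<close>.\<close>
  also have "(\<Sum>a\<in>UNIV. \<Sum>b\<in>UNIV. \<Sum>c\<in>UNIV. (p a b c + p b c a + p c a b) * ?q a b c) =
      ?T + (\<Sum>a\<in>UNIV. \<Sum>b\<in>UNIV. \<Sum>c\<in>UNIV. p b c a * ?q b c a)
      + (\<Sum>a\<in>UNIV. \<Sum>b\<in>UNIV. \<Sum>c\<in>UNIV. p c a b * ?q c a b)"
    unfolding sum.distrib[symmetric] by (intro sum.cong refl) (simp add: algebra_simps)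
  also have "(\<Sum>a\<in>UNIV. \<Sum>b\<in>UNIV. \<Sum>c\<in>UNIV. p b c a * ?q b c a) = ?T"
    by (rule cyc)
  also have "(\<Sum>a\<in>UNIV. \<Sum>b\<in>UNIV. \<Sum>c\<in>UNIV. p c a b * ?q c a b) = ?T"
    by (rule cyc[symmetric])
  also have "?T = (\<Sum>a\<in>UNIV. \<Sum>b\<in>UNIV. \<Sum>c\<in>UNIV. p a b c * q a b c)
      + (\<Sum>a\<in>UNIV. \<Sum>b\<in>UNIV. \<Sum>c\<in>UNIV. p a b c * q b c a)
      + (\<Sum>a\<in>UNIV. \<Sum>b\<in>UNIV. \<Sum>c\<in>UNIV. p a b c * q c a b)"
    unfolding sum.distrib[symmetric] by (intro sum.cong refl) (simp add: algebra_simps)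
  also have "(\<Sum>a\<in>UNIV. \<Sum>b\<in>UNIV. \<Sum>c\<in>UNIV. p a b c * q a b c) = (z \<bullet> m) * (X \<bullet> \<psi>)"
  proof -
    have "(\<Sum>b\<in>UNIV. \<Sum>c\<in>UNIV. p a b c * q a b c) = (z $ a * m $ a) * (X \<bullet> \<psi>)" for a
      by (simp add: inner_vec_def p_def q_def sum_distrib_left ac_simps)
    then show ?thesis
      by (simp add: sum_distrib_right[symmetric]) (simp add: inner_vec_def)
  qed
  also have "(\<Sum>a\<in>UNIV. \<Sum>b\<in>UNIV. \<Sum>c\<in>UNIV. p a b c * q b c a) = - ((X *v m) \<bullet> (\<psi> *v z))"
  proof -
    have "(X *v m) $ c * (\<psi> *v z) $ c = - (\<Sum>a\<in>UNIV. \<Sum>b\<in>UNIV. p a b c * q b c a)" for c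
    proof -
      have "(X *v m) $ c = - (\<Sum>b\<in>UNIV. X $ b $ c * m $ b)"
        unfolding matrix_vector_mult_def sum_negf[symmetric]
        by (auto simp: antisym_component[OF assms(1), of c] intro!: sum.cong)
      moreover have "(\<psi> *v z) $ c * (\<Sum>b\<in>UNIV. X $ b $ c * m $ b)
          = (\<Sum>a\<in>UNIV. \<Sum>b\<in>UNIV. p a b c * q b c a)"
        unfolding matrix_vector_mult_def vec_lambda_beta
        by (subst sum_product) (simp add: p_def q_def ac_simps)
      ultimately show ?thesis by (simp add: mult.commute)
    qed
    then have "- ((X *v m) \<bullet> (\<psi> *v z)) = (\<Sum>c\<in>UNIV. \<Sum>a\<in>UNIV. \<Sum>b\<in>UNIV. p a b c * q b c a)"
      by (simp add: inner_vec_def sum_negf)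
    also have "\<dots> = (\<Sum>a\<in>UNIV. \<Sum>b\<in>UNIV. \<Sum>c\<in>UNIV. p a b c * q b c a)"
      by (rule cyc)
    finally show ?thesis by simp
  qed
  also have "(\<Sum>a\<in>UNIV. \<Sum>b\<in>UNIV. \<Sum>c\<in>UNIV. p a b c * q c a b) = - ((X *v m) \<bullet> (\<psi> *v z))"
  proof -
    have "(X *v m) $ b * (\<psi> *v z) $ b = - (\<Sum>c\<in>UNIV. \<Sum>a\<in>UNIV. p a b c * q c a b)" for b
    proof -
      have "(\<psi> *v z) $ b = - (\<Sum>a\<in>UNIV. \<psi> $ a $ b * z $ a)"
        unfolding matrix_vector_mult_def sum_negf[symmetric]
        by (auto simp: antisym_component[OF assms(2), of b] intro!: sum.cong)
      moreover have "(X *v m) $ b * (\<Sum>a\<in>UNIV. \<psi> $ a $ b * z $ a)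
          = (\<Sum>c\<in>UNIV. \<Sum>a\<in>UNIV. p a b c * q c a b)"
        unfolding matrix_vector_mult_def
        by (simp add: sum_product p_def q_def ac_simps)
      ultimately show ?thesis by simp
    qed
    then have "- ((X *v m) \<bullet> (\<psi> *v z)) = (\<Sum>b\<in>UNIV. \<Sum>c\<in>UNIV. \<Sum>a\<in>UNIV. p a b c * q c a b)"
      by (simp add: inner_vec_def sum_negf)
    also have "\<dots> = (\<Sum>a\<in>UNIV. \<Sum>b\<in>UNIV. \<Sum>c\<in>UNIV. p a b c * q c a b)"
      by (rule cyc[symmetric])
    finally show ?thesis by simp
  qed
  finally show ?thesis by simp
qed

lemma transpose_gordon_up: "transpose (gordon_up n \<xi>) = gordon_up n \<xi>"
  by (auto simp: transpose_def vec_eq_iff intro: gordon_up_sym)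

lemma matrix_mult_minus_right: "M ** (- N) = - (M ** N)" for M N :: tensor2
  by (simp add: matrix_matrix_mult_def vec_eq_iff sum_negf)

lemma matrix_mult_minus_left: "(- M) ** N = - (M ** N)" for M N :: tensor2
  by (simp add: matrix_matrix_mult_def vec_eq_iff sum_negf)

lemma antisym_congruence:
  "\<phi> \<in> antisym_tensors \<Longrightarrow> M ** \<phi> ** transpose M \<in> antisym_tensors"
  by (simp add: antisym_tensors_def matrix_transpose_mul matrix_mul_assoc matrix_mult_minus_right
      matrix_mult_minus_left)

text \<open>The factor 3/2 in \<open>maxwell_h\<close> against the 1/3 from the alternation gives
  the mixed term of the cyclic equation coefficient 1. Moving the symmetric \<open>G\<close> across
  the inner product makes it the mirror image, under exchange of \<open>\<phi>\<close> and
  \<open>\<psi>\<close>, of the term from the divergence equation.\<close>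

lemma maxwell_contraction:
  assumes "\<phi> \<in> antisym_tensors" "\<psi> \<in> antisym_tensors"
  shows "maxwell_k n \<xi> x (maxwell_h n \<xi> \<zeta> x \<phi>) m \<psi> = maxwell_form (gordon_up n \<xi>) (\<zeta> x) m \<phi> \<psi>"
proof -
  define G where "G = gordon_up n \<xi>"
  have GT: "transpose G = G" by (simp add: G_def transpose_gordon_up)
  have "transpose (G ** \<phi> ** transpose G) = - (G ** \<phi> ** transpose G)" "transpose \<psi> = - \<psi>"
    using antisym_congruence[OF assms(1), of G] assms(2) by (auto simp: antisym_tensors_def)
  note * = inner_alt3_outer[OF this, of "\<zeta> x" m]
  have "((G ** \<phi> ** transpose G) *v m) \<bullet> (\<psi> *v \<zeta> x) = (\<phi> *v (G *v m)) \<bullet> (G *v (\<psi> *v \<zeta> x))"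
    by (simp add: GT matrix_vector_mul_assoc[symmetric] inner_matrix_vector[of _ G])
  with * show ?thesis
    unfolding maxwell_k_def maxwell_h_def maxwell_form_def G_def[symmetric] by simp
qed

section \<open>Behaviour of the form under a change of frame\<close>

lemma inner_matrix_mult_left: "(M ** X) \<bullet> Y = X \<bullet> (transpose M ** Y)" for M X Y :: tensor2
proof -
  have "(M ** X) \<bullet> Y = (\<Sum>a\<in>UNIV. \<Sum>b\<in>UNIV. \<Sum>k\<in>UNIV. M $ a $ k * X $ k $ b * Y $ a $ b)"
    by (simp add: inner_vec_def matrix_matrix_mult_def sum_distrib_right)
  also have "\<dots> = (\<Sum>a\<in>UNIV. \<Sum>k\<in>UNIV. \<Sum>b\<in>UNIV. M $ a $ k * X $ k $ b * Y $ a $ b)"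
    by (intro sum.cong refl sum.swap)
  also have "\<dots> = (\<Sum>k\<in>UNIV. \<Sum>a\<in>UNIV. \<Sum>b\<in>UNIV. M $ a $ k * X $ k $ b * Y $ a $ b)"
    by (rule sum.swap)
  also have "\<dots> = (\<Sum>k\<in>UNIV. \<Sum>b\<in>UNIV. \<Sum>a\<in>UNIV. M $ a $ k * X $ k $ b * Y $ a $ b)"
    by (intro sum.cong refl sum.swap)
  also have "\<dots> = X \<bullet> (transpose M ** Y)"
    by (simp add: inner_vec_def matrix_matrix_mult_def transpose_def sum_distrib_left ac_simps)
  finally show ?thesis .
qed

lemma inner_transpose: "transpose X \<bullet> transpose Y = X \<bullet> Y" for X Y :: tensor2
  unfolding inner_vec_def transpose_def by simp (rule sum.swap)

lemma inner_matrix_mult_right: "(X ** M) \<bullet> Y = X \<bullet> (Y ** transpose M)" for M X Y :: tensor2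
proof -
  have "(X ** M) \<bullet> Y = (transpose M ** transpose X) \<bullet> transpose Y"
    by (simp add: inner_transpose flip: matrix_transpose_mul)
  also have "\<dots> = transpose X \<bullet> transpose (Y ** transpose M)"
    by (simp add: inner_matrix_mult_left matrix_transpose_mul)
  finally show ?thesis by (simp add: inner_transpose)
qed

text \<open>Tensoriality: pushing the inverse metric and the vector forward by \<open>A\<close>
  amounts to pulling the covector and the field tensors back. It reduces positivity for Gordon's
  metric to the Minkowski case.\<close>

lemma maxwell_form_congruence:
  "maxwell_form (A ** G ** transpose A) (A *v z) m \<phi> \<psi> =
   maxwell_form G z (transpose A *v m) (transpose A ** \<phi> ** A) (transpose A ** \<psi> ** A)"
proof -
  define t where "t = transpose A"
  have t: "(A *v x) \<bullet> y = x \<bullet> (t *v y)" "x \<bullet> (A *v y) = (t *v x) \<bullet> y" for x y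
    by (simp_all add: t_def dot_lmul_matrix[symmetric] inner_commute)
  have "(A ** G ** t ** \<phi> ** transpose (A ** G ** t)) \<bullet> \<psi>
      = (A ** (G ** (t ** \<phi> ** A) ** transpose G) ** t) \<bullet> \<psi>"
    by (simp add: matrix_transpose_mul t_def matrix_mul_assoc)
  also have "\<dots> = (G ** (t ** \<phi> ** A) ** transpose G) \<bullet> (t ** \<psi> ** A)"
    using inner_matrix_mult_right[of "A ** (G ** (t ** \<phi> ** A) ** transpose G)" t \<psi>]
      inner_matrix_mult_left[of A "G ** (t ** \<phi> ** A) ** transpose G" "\<psi> ** A"]
    by (simp add: t_def matrix_mul_assoc)
  finally show ?thesis
    unfolding maxwell_form_def t_def[symmetric]
    by (simp add: matrix_vector_mul_assoc[symmetric] t)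
qed

section \<open>Positivity of the form in the rest frame of Minkowski space\<close>

lemma eta_matrix_mult: "(eta ** M) $ a $ b = (if a = 0 then M $ 0 $ b else - M $ a $ b)"
  using eta_vec_component[of "\<chi> i. M $ i $ b" a]
  by (simp add: matrix_matrix_mult_def matrix_vector_mult_def)

lemma matrix_mult_eta: "(M ** eta) $ a $ b = (if b = 0 then M $ a $ 0 else - M $ a $ b)"
  using eta_vec_component[of "M $ a" b]
  by (simp add: matrix_matrix_mult_def vec_eta)

lemma maxwell_form_scaleR:
  "maxwell_form G (s *\<^sub>R z) m \<phi> \<psi> = s * maxwell_form G z m \<phi> \<psi>"
  by (simp add: maxwell_form_def matrix_vector_mult_scaleR algebra_simps)

text \<open>
  With \<open>E\<close> and \<open>B\<close> the electric and magnetic parts of \<open>\<phi>\<close>, this is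
  \<open>m\<^sub>0 (|E|\<^sup>2 + |B|\<^sup>2) - 2 m \<cdot> (E \<times> B)\<close>: energy density and Poynting flux.
\<close>

lemma maxwell_form_eta:
  assumes "\<phi> \<in> antisym_tensors"
  shows "maxwell_form eta (axis 0 1) m \<phi> \<phi> =
    m $ 0 * ((\<phi> $ 0 $ 1)\<^sup>2 + (\<phi> $ 0 $ 2)\<^sup>2 + (\<phi> $ 0 $ 3)\<^sup>2
      + (\<phi> $ 2 $ 3)\<^sup>2 + (\<phi> $ 3 $ 1)\<^sup>2 + (\<phi> $ 1 $ 2)\<^sup>2)
    - 2 * (m $ 1 * (\<phi> $ 0 $ 2 * \<phi> $ 1 $ 2 - \<phi> $ 0 $ 3 * \<phi> $ 3 $ 1)
         + m $ 2 * (\<phi> $ 0 $ 3 * \<phi> $ 2 $ 3 - \<phi> $ 0 $ 1 * \<phi> $ 1 $ 2)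
         + m $ 3 * (\<phi> $ 0 $ 1 * \<phi> $ 3 $ 1 - \<phi> $ 0 $ 2 * \<phi> $ 2 $ 3))"
proof -
  have a: "\<phi> $ i $ j = - \<phi> $ j $ i" for i j
    using assms antisym_component[of \<phi> i j] by (simp add: antisym_tensors_def)
  have d: "\<phi> $ i $ i = 0" for i
    using a[of i i] by simp
  have \<phi>e: "\<phi> *v axis 0 1 = (\<chi> i. \<phi> $ i $ 0)"
    by (simp add: matrix_vector_mult_basis column_def)
  have \<phi>m: "(\<phi> *v (eta *v m)) $ i
      = \<phi> $ i $ 0 * m $ 0 - \<phi> $ i $ 1 * m $ 1 - \<phi> $ i $ 2 * m $ 2 - \<phi> $ i $ 3 * m $ 3" for i
    by (simp add: matrix_vector_mult_def[of \<phi>] sum_UNIV_4 eta_vec_component)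
  have energy: "(eta ** \<phi> ** transpose eta) \<bullet> \<phi> = 2 * ((\<phi> $ 2 $ 3)\<^sup>2 + (\<phi> $ 3 $ 1)\<^sup>2 + (\<phi> $ 1 $ 2)\<^sup>2
      - (\<phi> $ 0 $ 1)\<^sup>2 - (\<phi> $ 0 $ 2)\<^sup>2 - (\<phi> $ 0 $ 3)\<^sup>2)"
    by (simp add: inner_vec_def sum_UNIV_4 transpose_eta eta_matrix_mult matrix_mult_eta d
        a[of 1 0] a[of 2 0] a[of 3 0] a[of 2 1] a[of 3 2] a[of 1 3] power2_eq_square)
  have time: "axis 0 1 \<bullet> m = m $ 0"
    by (simp add: inner_axis')
  have flux: "(eta *v (\<phi> *v axis 0 1)) \<bullet> (\<phi> *v (eta *v m))
      = \<phi> $ 0 $ 1 * (\<phi> $ 3 $ 1 * m $ 3 - \<phi> $ 0 $ 1 * m $ 0 - \<phi> $ 1 $ 2 * m $ 2)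
      + \<phi> $ 0 $ 2 * (\<phi> $ 1 $ 2 * m $ 1 - \<phi> $ 0 $ 2 * m $ 0 - \<phi> $ 2 $ 3 * m $ 3)
      + \<phi> $ 0 $ 3 * (\<phi> $ 2 $ 3 * m $ 2 - \<phi> $ 0 $ 3 * m $ 0 - \<phi> $ 3 $ 1 * m $ 1)"
    unfolding \<phi>e
    by (simp add: inner_vec4 eta_vec_component \<phi>m d
        a[of 1 0] a[of 2 0] a[of 3 0] a[of 2 1] a[of 3 2] a[of 1 3] algebra_simps)
  show ?thesis
    unfolding maxwell_form_def inner_commute[of "\<phi> *v (eta *v m)"] energy time flux
    by (simp add: power2_eq_square field_simps)
qed

text \<open>Test fields: the parameters are the electric part, read at 01, 02, 03, and the magnetic
  part, read at the cyclic places 23, 31, 12.\<close>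

definition em_tensor :: "real \<Rightarrow> real \<Rightarrow> real \<Rightarrow> real \<Rightarrow> real \<Rightarrow> real \<Rightarrow> tensor2" where
  "em_tensor e1 e2 e3 b1 b2 b3 =
    (let f = (\<lambda>a b. if a = 0 \<and> b = 1 then e1 else if a = 0 \<and> b = 2 then e2
                else if a = 0 \<and> b = 3 then e3 else if a = 2 \<and> b = 3 then b1
                else if a = 3 \<and> b = 1 then b2 else if a = 1 \<and> b = 2 then b3 else 0)
     in \<chi> a b. f a b - f b a)"

lemma em_tensor_antisym: "em_tensor e1 e2 e3 b1 b2 b3 \<in> antisym_tensors"
  by (simp add: em_tensor_def Let_def antisym_tensors_def transpose_def vec_eq_iff)

lemma em_tensor_component:
  "em_tensor e1 e2 e3 b1 b2 b3 $ 0 $ 1 = e1" "em_tensor e1 e2 e3 b1 b2 b3 $ 0 $ 2 = e2"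
  "em_tensor e1 e2 e3 b1 b2 b3 $ 0 $ 3 = e3" "em_tensor e1 e2 e3 b1 b2 b3 $ 2 $ 3 = b1"
  "em_tensor e1 e2 e3 b1 b2 b3 $ 3 $ 1 = b2" "em_tensor e1 e2 e3 b1 b2 b3 $ 1 $ 2 = b3"
  by (simp_all add: em_tensor_def Let_def)

lemma sum_three_squares_pos_iff:
  fixes x y z :: real
  shows "0 < x\<^sup>2 + y\<^sup>2 + z\<^sup>2 \<longleftrightarrow> x \<noteq> 0 \<or> y \<noteq> 0 \<or> z \<noteq> 0"
  by (auto simp: add_pos_nonneg add_nonneg_pos)

lemma poynting_positive:
  fixes e1 e2 e3 b1 b2 b3 :: real
  assumes "m0 > 0" "m0\<^sup>2 > m1\<^sup>2 + m2\<^sup>2 + m3\<^sup>2"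
    and nz: "e1 \<noteq> 0 \<or> e2 \<noteq> 0 \<or> e3 \<noteq> 0 \<or> b1 \<noteq> 0 \<or> b2 \<noteq> 0 \<or> b3 \<noteq> 0"
  shows "m0 * (e1\<^sup>2 + e2\<^sup>2 + e3\<^sup>2 + b1\<^sup>2 + b2\<^sup>2 + b3\<^sup>2)
    - 2 * (m1 * (e2 * b3 - e3 * b2) + m2 * (e3 * b1 - e1 * b3) + m3 * (e1 * b2 - e2 * b1)) > 0"
    (is "?Q > 0")
\<comment> \<open>The strict term of the completed square below carries the factor
  \<open>|E|\<^sup>2\<close>, so a vanishing electric part is settled directly.\<close>
proof (cases "e1 = 0 \<and> e2 = 0 \<and> e3 = 0")
  case True
  with nz have "0 < b1\<^sup>2 + b2\<^sup>2 + b3\<^sup>2"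
    by (simp add: sum_three_squares_pos_iff)
  with True assms(1) show ?thesis by simp
next
  case False
  then have E: "0 < e1\<^sup>2 + e2\<^sup>2 + e3\<^sup>2"
    by (simp add: sum_three_squares_pos_iff)
  \<comment> \<open>Complete the square: \<open>m\<^sub>0 Q = |m\<^sub>0 B - m \<times> E|\<^sup>2 + (m \<cdot> E)\<^sup>2 + (m\<^sub>0\<^sup>2 - |m|\<^sup>2) |E|\<^sup>2\<close>.\<close>
  have "m0 * ?Q = (m0 * b1 - (m2 * e3 - m3 * e2))\<^sup>2 + (m0 * b2 - (m3 * e1 - m1 * e3))\<^sup>2
      + (m0 * b3 - (m1 * e2 - m2 * e1))\<^sup>2 + (m1 * e1 + m2 * e2 + m3 * e3)\<^sup>2
      + (m0\<^sup>2 - (m1\<^sup>2 + m2\<^sup>2 + m3\<^sup>2)) * (e1\<^sup>2 + e2\<^sup>2 + e3\<^sup>2)"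
    by (simp add: power2_eq_square algebra_simps)
  also have "\<dots> > 0"
    using mult_pos_pos[OF _ E, of "m0\<^sup>2 - (m1\<^sup>2 + m2\<^sup>2 + m3\<^sup>2)"] assms(2)
    by (intro add_nonneg_pos add_nonneg_nonneg zero_le_power2) simp
  finally show ?thesis
    using assms(1) by (simp add: zero_less_mult_iff)
qed

text \<open>Sufficiency is the completed square; necessity follows from evaluating the form on a
  pure electric field and on a field that minimises it.\<close>

lemma eta_positive_iff:
  "(\<forall>\<phi>\<in>antisym_tensors. \<phi> \<noteq> 0 \<longrightarrow> maxwell_form eta (axis 0 1) m \<phi> \<phi> > 0)
    \<longleftrightarrow> timelike eta m \<and> m $ 0 > 0"
proof (intro iffI ballI impI)
  fix \<phi> :: tensor2
  assume m: "timelike eta m \<and> m $ 0 > 0" and \<phi>: "\<phi> \<in> antisym_tensors" "\<phi> \<noteq> 0"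
  have a: "\<phi> $ i $ j = - \<phi> $ j $ i" for i j
    using \<phi> antisym_component[of \<phi> i j] by (simp add: antisym_tensors_def)
  have d: "\<phi> $ i $ i = 0" for i
    using a[of i i] by simp
  have "\<phi> $ 0 $ 1 \<noteq> 0 \<or> \<phi> $ 0 $ 2 \<noteq> 0 \<or> \<phi> $ 0 $ 3 \<noteq> 0 \<or>
      \<phi> $ 2 $ 3 \<noteq> 0 \<or> \<phi> $ 3 $ 1 \<noteq> 0 \<or> \<phi> $ 1 $ 2 \<noteq> 0"
    using \<phi>(2) by (auto simp: vec_eq_iff forall_UNIV_4 d
        a[of 1 0] a[of 2 0] a[of 3 0] a[of 2 1] a[of 3 2] a[of 1 3])
  moreover have "(m $ 0)\<^sup>2 > (m $ 1)\<^sup>2 + (m $ 2)\<^sup>2 + (m $ 3)\<^sup>2"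
    using m by (simp add: timelike_def inner_eta power2_eq_square)
  ultimately show "maxwell_form eta (axis 0 1) m \<phi> \<phi> > 0"
    unfolding maxwell_form_eta[OF \<phi>(1)] using m by (intro poynting_positive) auto
next
  assume *: "\<forall>\<phi>\<in>antisym_tensors. \<phi> \<noteq> 0 \<longrightarrow> maxwell_form eta (axis 0 1) m \<phi> \<phi> > 0"
  have pos: "m $ 0 * (e1\<^sup>2 + e2\<^sup>2 + e3\<^sup>2 + b1\<^sup>2 + b2\<^sup>2 + b3\<^sup>2)
      - 2 * (m $ 1 * (e2 * b3 - e3 * b2) + m $ 2 * (e3 * b1 - e1 * b3)
        + m $ 3 * (e1 * b2 - e2 * b1)) > 0" if "e1 \<noteq> 0 \<or> e2 \<noteq> 0" for e1 e2 e3 b1 b2 b3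
  proof -
    let ?\<phi> = "em_tensor e1 e2 e3 b1 b2 b3"
    have "?\<phi> \<noteq> 0"
      using that em_tensor_component(1,2)[of e1 e2 e3 b1 b2 b3] by auto
    then have "maxwell_form eta (axis 0 1) m ?\<phi> ?\<phi> > 0"
      using * em_tensor_antisym by blast
    then show ?thesis
      by (simp add: maxwell_form_eta[OF em_tensor_antisym] em_tensor_component)
  qed
  \<comment> \<open>Tested on a unit electric field without magnetic part.\<close>
  have m0: "m $ 0 > 0"
    using pos[of 1 0 0 0 0 0] by simp
  \<comment> \<open>The form is smallest at \<open>B = (m \<times> E) / m\<^sub>0\<close> with \<open>E\<close> orthogonal to \<open>m\<close>.\<close>
  have "(m $ 0)\<^sup>2 > (m $ 1)\<^sup>2 + (m $ 2)\<^sup>2 + (m $ 3)\<^sup>2"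
  proof -
    \<comment> \<open>A nonzero electric field in the 1-2 plane orthogonal to \<open>m\<close>: any
      direction if \<open>m\<close> has no component there, otherwise that component turned by a
      right angle. Then \<open>c1\<close>, \<open>c2\<close>, \<open>c3\<close> below form the cross
      product of \<open>m\<close> with it.\<close>
    obtain e1 e2 where e: "e1 \<noteq> 0 \<or> e2 \<noteq> 0" "m $ 1 * e1 + m $ 2 * e2 = 0"
    proof (cases "m $ 1 = 0 \<and> m $ 2 = 0")
      case True
      then show ?thesis using that[of 1 0] by simp
    next
      case False
      then show ?thesis using that[of "m $ 2" "- m $ 1"] by auto
    qed
    define c1 c2 c3 where "c1 = - m $ 3 * e2" and "c2 = m $ 3 * e1" and "c3 = m $ 1 * e2 - m $ 2 * e1"
    have "m $ 0 * (e1\<^sup>2 + e2\<^sup>2 + 0\<^sup>2 + (c1 / m $ 0)\<^sup>2 + (c2 / m $ 0)\<^sup>2 + (c3 / m $ 0)\<^sup>2)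
      - 2 * (m $ 1 * (e2 * (c3 / m $ 0) - 0 * (c2 / m $ 0)) + m $ 2 * (0 * (c1 / m $ 0) - e1 * (c3 / m $ 0))
        + m $ 3 * (e1 * (c2 / m $ 0) - e2 * (c1 / m $ 0))) > 0" (is "?Q > 0")
      by (rule pos[OF e(1)])
    then have "0 < m $ 0 * ?Q"
      by (rule mult_pos_pos[OF m0])
    also have "m $ 0 * ?Q = (m $ 0)\<^sup>2 * (e1\<^sup>2 + e2\<^sup>2) - (c1\<^sup>2 + c2\<^sup>2 + c3\<^sup>2)"
      using m0 by (simp add: field_simps power2_eq_square c1_def c2_def c3_def)
    \<comment> \<open>Lagrange's identity again; the last square vanishes by orthogonality.\<close>
    also have "c1\<^sup>2 + c2\<^sup>2 + c3\<^sup>2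
        = ((m $ 1)\<^sup>2 + (m $ 2)\<^sup>2 + (m $ 3)\<^sup>2) * (e1\<^sup>2 + e2\<^sup>2) - (m $ 1 * e1 + m $ 2 * e2)\<^sup>2"
      by (simp add: c1_def c2_def c3_def power2_eq_square algebra_simps)
    finally have "((m $ 0)\<^sup>2 - ((m $ 1)\<^sup>2 + (m $ 2)\<^sup>2 + (m $ 3)\<^sup>2)) * (e1\<^sup>2 + e2\<^sup>2) > 0"
      using e(2) by (simp add: left_diff_distrib)
    moreover have "e1\<^sup>2 + e2\<^sup>2 > 0"
      using e(1) by (simp add: sum_power2_gt_zero_iff)
    ultimately show ?thesis
      by (simp add: zero_less_mult_iff)
  qed
  then show "timelike eta m \<and> m $ 0 > 0"
    using m0 by (simp add: timelike_def inner_eta power2_eq_square)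
qed

section \<open>Frames and cones\<close>

lemma matrix_mult_0: "0 ** M = 0" "M ** 0 = 0" for M :: tensor2
  by (simp_all add: matrix_matrix_mult_def vec_eq_iff)

text \<open>For timelike \<open>z\<close> this is the lobe containing \<open>z\<close> with its apex
  removed. Leaving out \<open>0\<close> makes it a connected component; \<open>insert 0\<close>
  recovers the lobe.\<close>

definition future_cone :: "tensor2 \<Rightarrow> vec4 \<Rightarrow> vec4 set" where
  "future_cone g z = {v. v \<noteq> 0 \<and> causal g v \<and> v \<bullet> (g *v z) > 0}"

text \<open>
  The columns of \<open>A\<close> form a frame that is orthonormal for the metric \<open>g\<close> (with inverse \<open>G\<close>)
  and whose timelike leg is along \<open>z\<close>.
\<close>

locale adapted_frame =
  fixes g G :: tensor2 and z :: vec4 and A B :: tensor2 and s :: real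
  assumes frame_inverse: "A ** B = mat 1"
    and metric: "g = transpose B ** eta ** B"
    and inverse_metric: "G = A ** eta ** transpose A"
    and timelike_leg: "z = s *\<^sub>R (A *v axis 0 1)"
    and scale: "s > 0"
begin

lemma coframe_inverse: "B ** A = mat 1"
  using frame_inverse by (simp add: matrix_left_right_inverse)

lemma frame_coframe: "A *v (B *v v) = v" and coframe_frame: "B *v (A *v v) = v"
  by (simp_all add: matrix_vector_mul_assoc frame_inverse coframe_inverse)

lemma inner_metric: "u \<bullet> (g *v v) = (B *v u) \<bullet> (eta *v (B *v v))"
  unfolding metric matrix_vector_mul_assoc[symmetric]
  by (simp only: inner_matrix_vector[of u "transpose B"] transpose_transpose)

lemma inner_inverse_metric:
  "m \<bullet> (G *v m) = (transpose A *v m) \<bullet> (eta *v (transpose A *v m))"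
  unfolding inverse_metric matrix_vector_mul_assoc[symmetric]
  by (rule inner_matrix_vector)

lemma coframe_timelike_leg: "B *v z = s *\<^sub>R axis 0 1"
  by (simp add: timelike_leg matrix_vector_mult_scaleR coframe_frame)

lemma inner_metric_leg: "v \<bullet> (g *v z) = s * (B *v v) $ 0"
  by (simp add: inner_metric coframe_timelike_leg inner_eta) (simp add: axis_def)

lemma inner_leg: "m \<bullet> z = s * (transpose A *v m) $ 0"
  unfolding timelike_leg by (simp only: inner_scaleR_right inner_matrix_vector) (simp add: inner_axis)

text \<open>Vectors take frame components through \<open>B\<close>, covectors through
  \<open>transpose A\<close>; since \<open>A\<close> and \<open>B\<close> are inverse, the pairing
  is kept.\<close>

lemma inner_frame: "v \<bullet> m = (B *v v) \<bullet> (transpose A *v m)"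
  using inner_matrix_vector[of m A "B *v v"] by (simp only: frame_coframe inner_commute)

lemma causal_frame: "causal g v \<longleftrightarrow> causal eta (B *v v)"
  by (simp add: causal_alt inner_metric)

lemma timelike_covector_frame: "timelike G m \<longleftrightarrow> timelike eta (transpose A *v m)"
  by (simp only: timelike_def inner_inverse_metric)

lemma coframe_eq_0: "B *v v = 0 \<longleftrightarrow> v = 0"
  by (metis frame_coframe matrix_vector_mult_0_right)

text \<open>Gives surjectivity of \<open>transpose A\<close>, so that quantifiers over covectors
  pass to Minkowski space.\<close>

lemma transpose_coframe: "transpose A *v (transpose B *v m) = m"
  by (simp only: matrix_vector_mul_assoc matrix_transpose_mul[symmetric] coframe_inverse
      transpose_mat matrix_vector_mul_lid)

lemma maxwell_form_frame:
  "maxwell_form G z m \<phi> \<psi> = s * maxwell_form eta (axis 0 1) (transpose A *v m)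
     (transpose A ** \<phi> ** A) (transpose A ** \<psi> ** A)"
  by (simp only: inverse_metric timelike_leg maxwell_form_scaleR maxwell_form_congruence)

text \<open>Pulling back by \<open>A\<close> permutes the nonzero antisymmetric tensors and
  \<open>s\<close> is positive, so positivity is the same question as in the rest frame.\<close>

lemma maxwell_form_positive_iff:
  "(\<forall>\<phi>\<in>antisym_tensors. \<phi> \<noteq> 0 \<longrightarrow> maxwell_form G z m \<phi> \<phi> > 0)
    \<longleftrightarrow> timelike G m \<and> m \<bullet> z > 0"
proof -
  let ?T = "\<lambda>\<phi>. transpose A ** \<phi> ** A" and ?U = "\<lambda>\<phi>. transpose B ** \<phi> ** B"
  have AB: "transpose B ** transpose A = mat 1" "transpose A ** transpose B = mat 1"
    by (simp_all only: matrix_transpose_mul[symmetric] frame_inverse coframe_inverse transpose_mat)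
  have UT: "?U (?T \<phi>) = \<phi>" and TU: "?T (?U \<phi>) = \<phi>" for \<phi>
  proof -
    have "?U (?T \<phi>) = (transpose B ** transpose A) ** \<phi> ** (A ** B)"
      "?T (?U \<phi>) = (transpose A ** transpose B) ** \<phi> ** (B ** A)"
      by (simp_all only: matrix_mul_assoc)
    then show "?U (?T \<phi>) = \<phi>" "?T (?U \<phi>) = \<phi>"
      by (simp_all only: AB frame_inverse coframe_inverse matrix_mul_lid matrix_mul_rid)
  qed
  have "(\<forall>\<phi>\<in>antisym_tensors. \<phi> \<noteq> 0 \<longrightarrow> maxwell_form G z m \<phi> \<phi> > 0)
      \<longleftrightarrow> (\<forall>\<phi>\<in>antisym_tensors. \<phi> \<noteq> 0 \<longrightarrow>
        maxwell_form eta (axis 0 1) (transpose A *v m) (?T \<phi>) (?T \<phi>) > 0)"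
    using scale by (simp only: maxwell_form_frame zero_less_mult_iff) auto
  also have "\<dots> \<longleftrightarrow> (\<forall>\<phi>\<in>antisym_tensors. \<phi> \<noteq> 0 \<longrightarrow>
        maxwell_form eta (axis 0 1) (transpose A *v m) \<phi> \<phi> > 0)"
  proof -
    have "?T ` (antisym_tensors - {0}) = antisym_tensors - {0}"
    proof (intro equalityI subsetI)
      fix \<phi> assume "\<phi> \<in> ?T ` (antisym_tensors - {0})"
      then obtain \<psi> where c: "\<psi> \<in> antisym_tensors" "\<psi> \<noteq> 0" "\<phi> = ?T \<psi>" by auto
      moreover have "\<phi> \<noteq> 0"
        using c UT[of \<psi>] by (auto simp: matrix_mult_0)
      ultimately show "\<phi> \<in> antisym_tensors - {0}"
        using antisym_congruence[of \<psi> "transpose A"] by simp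
    next
      fix \<phi> assume p: "\<phi> \<in> antisym_tensors - {0}"
      moreover have "?U \<phi> \<noteq> 0"
        using p TU[of \<phi>] by (auto simp: matrix_mult_0)
      ultimately have "?U \<phi> \<in> antisym_tensors - {0}"
        using antisym_congruence[of \<phi> "transpose B"] by simp
      then show "\<phi> \<in> ?T ` (antisym_tensors - {0})"
        using TU[of \<phi>] by (metis imageI)
    qed
    then have "(\<forall>\<phi>\<in>antisym_tensors - {0}. P (?T \<phi>)) \<longleftrightarrow> (\<forall>\<phi>\<in>antisym_tensors - {0}. P \<phi>)" for P
      by (metis (no_types, lifting) image_iff)
    from this[of "\<lambda>\<phi>. maxwell_form eta (axis 0 1) (transpose A *v m) \<phi> \<phi> > 0"]
    show ?thesis by blast
  qed
  also have "\<dots> \<longleftrightarrow> timelike G m \<and> m \<bullet> z > 0"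
    using scale by (simp only: eta_positive_iff timelike_covector_frame inner_leg zero_less_mult_iff) auto
  finally show ?thesis .
qed

lemma dual_cone:
  "{v. \<forall>m. timelike G m \<and> m \<bullet> z > 0 \<longrightarrow> v \<bullet> m \<ge> 0} = insert 0 (future_cone g z)"
proof -
  have "(\<forall>m. timelike G m \<and> m \<bullet> z > 0 \<longrightarrow> v \<bullet> m \<ge> 0) \<longleftrightarrow> v \<in> insert 0 (future_cone g z)" for v
  proof -
    have "(\<forall>m. timelike G m \<and> m \<bullet> z > 0 \<longrightarrow> v \<bullet> m \<ge> 0) \<longleftrightarrow>
        (\<forall>m. timelike eta (transpose A *v m) \<and> (transpose A *v m) $ 0 > 0
          \<longrightarrow> (B *v v) \<bullet> (transpose A *v m) \<ge> 0)"
      using scale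
      by (simp only: timelike_covector_frame inner_leg zero_less_mult_iff inner_frame[of v]) auto
    also have "\<dots> \<longleftrightarrow> (\<forall>m. timelike eta m \<and> m $ 0 > 0 \<longrightarrow> (B *v v) \<bullet> m \<ge> 0)"
      by (metis transpose_coframe)
    also have "\<dots> \<longleftrightarrow> causal eta (B *v v) \<and> (B *v v) $ 0 \<ge> 0"
      by (rule eta_dual_cone)
    also have "\<dots> \<longleftrightarrow> v \<in> insert 0 (future_cone g z)"
    proof (cases "v = 0")
      case True
      then show ?thesis by (simp add: causal_alt)
    next
      case False
      \<comment> \<open>Away from \<open>0\<close> the closed condition on the time component
        becomes strict, as \<open>future_cone\<close> requires.\<close>
      then have "causal eta (B *v v) \<Longrightarrow> (B *v v) $ 0 \<noteq> 0"
        using eta_causal_time_nonzero coframe_eq_0 by blast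
      with False scale show ?thesis
        by (auto simp: future_cone_def causal_frame inner_metric_leg zero_less_mult_iff)
    qed
    finally show ?thesis .
  qed
  then show ?thesis by blast
qed

text \<open>The hyperplane \<open>g\<close>-orthogonal to \<open>z\<close> contains no nonzero
  causal vector, so it separates the two lobes.\<close>

lemma inner_metric_leg_nonzero: "causal g v \<Longrightarrow> v \<noteq> 0 \<Longrightarrow> v \<bullet> (g *v z) \<noteq> 0"
  using scale eta_causal_time_nonzero[of "B *v v"]
  by (simp add: causal_frame inner_metric_leg coframe_eq_0)

lemma timelike_leg_in_cone: "z \<in> future_cone g z"
proof -
  have "z \<bullet> (g *v z) > 0"
    using scale by (simp add: inner_metric_leg coframe_timelike_leg)
  then show ?thesis
    by (auto simp: future_cone_def causal_alt)
qed

text \<open>Duality presents the cone with its apex as an intersection of closed half-spaces; the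
  open half-space of vectors positive on \<open>g *v z\<close> removes the apex.\<close>

lemma convex_future_cone: "convex (future_cone g z)"
proof -
  have "future_cone g z = insert 0 (future_cone g z) \<inter> {v. (g *v z) \<bullet> v > 0}"
    by (auto simp: future_cone_def inner_commute)
  also have "insert 0 (future_cone g z) = (\<Inter>m\<in>{m. timelike G m \<and> m \<bullet> z > 0}. {v. m \<bullet> v \<ge> 0})"
    unfolding dual_cone[symmetric] by (auto simp: inner_commute)
  finally have eq: "future_cone g z =
      (\<Inter>m\<in>{m. timelike G m \<and> m \<bullet> z > 0}. {v. m \<bullet> v \<ge> 0}) \<inter> {v. (g *v z) \<bullet> v > 0}" .
  show ?thesis
    unfolding eq by (intro convex_Int convex_INT convex_halfspace_ge convex_halfspace_gt)
qed

text \<open>Convexity gives connectedness. For maximality, a connected set of nonzero causal vectors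
  joining \<open>z\<close> to a point outside the cone would cross the hyperplane orthogonal to
  \<open>z\<close>, where there are none.\<close>

lemma future_cone_component: "future_cone g z \<in> components {v. v \<noteq> 0 \<and> causal g v}"
proof -
  let ?S = "{v. v \<noteq> 0 \<and> causal g v}"
  have sub: "future_cone g z \<subseteq> ?S"
    by (auto simp: future_cone_def)
  have "connected_component_set ?S z = future_cone g z"
  proof
    show "future_cone g z \<subseteq> connected_component_set ?S z"
      by (rule connected_component_maximal[OF timelike_leg_in_cone
            convex_connected[OF convex_future_cone] sub])
    show "connected_component_set ?S z \<subseteq> future_cone g z"
    proof
      fix v assume v: "v \<in> connected_component_set ?S z"
      have T: "connected_component_set ?S z \<subseteq> ?S"
        by (rule connected_component_subset)
      have "v \<bullet> (g *v z) > 0"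
      proof (rule ccontr)
        assume "\<not> v \<bullet> (g *v z) > 0"
        moreover have "z \<bullet> (g *v z) > 0"
          using timelike_leg_in_cone by (simp add: future_cone_def)
        moreover have "z \<in> connected_component_set ?S z"
          using timelike_leg_in_cone sub by auto
        ultimately obtain u where "u \<in> connected_component_set ?S z" "(g *v z) \<bullet> u = 0"
          using connected_ivt_hyperplane[OF connected_connected_component v, of z "g *v z" 0]
          by (auto simp: inner_commute)
        with T inner_metric_leg_nonzero[of u] show False
          by (auto simp: inner_commute)
      qed
      with v T show "v \<in> future_cone g z"
        by (auto simp: future_cone_def)
    qed
  qed
  then show ?thesis
    using timelike_leg_in_cone sub by (auto simp: components_def)
qed

text \<open>The frame carries a Minkowski null vector to the boundary of the cone. It serves to show
  that inclusions of cones are proper.\<close>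

lemma null_vector_in_cone: "\<exists>v \<in> future_cone g z. \<not> timelike g v"
proof -
  define w :: vec4 where "w = axis 0 1 + axis 1 1"
  have w: "w $ 0 = 1" "w $ 1 = 1" "w $ 2 = 0" "w $ 3 = 0"
    by (simp_all add: w_def axis_def)
  define v where "v = A *v w"
  have v: "B *v v = w"
    by (simp add: v_def coframe_frame)
  have "v \<noteq> 0"
    using v w(1) by auto
  moreover have "v \<bullet> (g *v v) = 0"
    by (simp add: inner_metric v inner_eta w)
  moreover have "v \<bullet> (g *v z) = s"
    by (simp add: inner_metric_leg v w)
  ultimately have "v \<in> future_cone g z" "\<not> timelike g v"
    using scale by (simp_all add: future_cone_def causal_alt timelike_def)
  then show ?thesis by blast
qed

end

text \<open>The first cone is connected and meets the second at \<open>z\<close>, hence lies in that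
  component. A null vector of the second cone is not in the first, all of whose vectors are timelike
  for \<open>g'\<close>.\<close>

lemma future_cone_psubset:
  assumes "adapted_frame g G z A B s" "adapted_frame g' G' z' A' B' s'"
    and wider: "\<And>v. v \<noteq> 0 \<Longrightarrow> causal g v \<Longrightarrow> timelike g' v"
    and "z \<bullet> (g' *v z') > 0"
  shows "future_cone g z \<subset> future_cone g' z'"
proof
  interpret f: adapted_frame g G z A B s by fact
  interpret f': adapted_frame g' G' z' A' B' s' by fact
  have z: "z \<noteq> 0" "causal g z"
    using f.timelike_leg_in_cone by (auto simp: future_cone_def)
  show "future_cone g z \<subseteq> future_cone g' z'"
  proof (rule components_maximal[OF f'.future_cone_component])
    show "connected (future_cone g z)"
      by (rule convex_connected[OF f.convex_future_cone])
    show "future_cone g z \<subseteq> {v. v \<noteq> 0 \<and> causal g' v}"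
      using wider by (auto simp: future_cone_def causal_def)
    have "z \<in> future_cone g' z'"
      using z wider[OF z] assms(4) by (auto simp: future_cone_def causal_def)
    then show "future_cone g' z' \<inter> future_cone g z \<noteq> {}"
      using f.timelike_leg_in_cone by auto
  qed
  show "future_cone g z \<noteq> future_cone g' z'"
    using f'.null_vector_in_cone wider by (auto simp: future_cone_def)
qed

section \<open>Gordon's metric\<close>

lemma inner_gordon:
  "u \<bullet> (gordon n \<xi> *v v) = u \<bullet> (eta *v v) + (1 - n\<^sup>2) / n\<^sup>2 * (u \<bullet> (eta *v \<xi>)) * (v \<bullet> (eta *v \<xi>))"
proof -
  define c where "c = (1 - n\<^sup>2) / n\<^sup>2"
  define w where "w = eta *v \<xi>"
  have "gordon n \<xi> *v v = eta *v v + (c * (v \<bullet> w)) *\<^sub>R w"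
  proof -
    have "gordon n \<xi> $ a $ j = eta $ a $ j + c * w $ a * w $ j" for a j
      by (simp add: gordon_def c_def w_def)
    then show ?thesis
      unfolding matrix_vector_mult_def[of "gordon n \<xi>"] matrix_vector_mult_def[of eta v]
      by (simp add: vec_eq_iff algebra_simps sum.distrib inner_vec_def sum_distrib_left
          sum_distrib_right)
  qed
  then show ?thesis
    by (simp add: inner_add_right c_def w_def ac_simps)
qed

lemma gordon_1: "gordon 1 \<xi> = eta" "gordon_up 1 \<xi> = eta"
  by (simp_all add: gordon_def gordon_up_def vec_eq_iff)

lemma transpose_gordon: "transpose (gordon n \<xi>) = gordon n \<xi>"
  unfolding gordon_def transpose_def vec_eq_iff
  by (auto simp: eta_sym[of _ "_ :: 4"] intro: eta_sym)

text \<open>The frame is the composition of two maps: \<open>R\<close> preserves \<open>eta\<close>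
  and turns the time axis towards the preimage of \<open>z\<close>, and the stretch \<open>f\<close>
  is an isometry from \<open>eta\<close> to Gordon's metric.\<close>

lemma adapted_frame_gordon:
  assumes "\<xi> \<bullet> (eta *v \<xi>) = 1" "n > 0" "timelike (gordon n \<xi>) z"
  obtains A B s where "adapted_frame (gordon n \<xi>) (gordon_up n \<xi>) z A B s"
proof -
  define ip where "ip x y = x \<bullet> (eta *v y)" for x y
  have ip_simps: "ip (x + y) v = ip x v + ip y v" "ip v (x + y) = ip v x + ip v y"
    "ip (x - y) v = ip x v - ip y v" "ip v (x - y) = ip v x - ip v y"
    "ip (r *\<^sub>R x) v = r * ip x v" "ip v (r *\<^sub>R x) = r * ip v x" for x y v r
    by (simp_all add: ip_def inner_eta algebra_simps)
  have ip_sym: "ip x y = ip y x" for x y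
    by (simp add: ip_def inner_eta ac_simps)
  have xi: "ip \<xi> \<xi> = 1"
    using assms(1) by (simp add: ip_def)
  have gip: "x \<bullet> (gordon n \<xi> *v y) = ip x y + (1 - n\<^sup>2) / n\<^sup>2 * ip x \<xi> * ip y \<xi>" for x y
    unfolding ip_def by (rule inner_gordon)
  \<comment> \<open>Stretching by \<open>n\<close> along \<open>\<xi>\<close> turns \<open>eta\<close> into Gordon's metric.\<close>
  define f where "f x = x + ((n - 1) * ip x \<xi>) *\<^sub>R \<xi>" for x
  have lin_f: "linear f"
    by (rule linearI) (simp_all add: f_def ip_simps algebra_simps)
  have f_ip: "f x \<bullet> (gordon n \<xi> *v f y) = ip x y" for x y
  proof -
    have "ip (f x) \<xi> = n * ip x \<xi>" for x
      by (simp add: f_def ip_simps xi algebra_simps)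
    then have "f x \<bullet> (gordon n \<xi> *v f y) = ip (f x) (f y) + (1 - n\<^sup>2) * ip x \<xi> * ip y \<xi>"
      using assms(2) by (simp add: gip power2_eq_square)
    also have "ip (f x) (f y) = ip x y + (n\<^sup>2 - 1) * ip x \<xi> * ip y \<xi>"
      by (simp add: f_def ip_simps xi ip_sym[of \<xi> y] power2_eq_square algebra_simps)
    finally show ?thesis
      by (simp add: algebra_simps)
  qed
  \<comment> \<open>The preimage of \<open>z\<close> under \<open>f\<close>: the component along
    \<open>\<xi>\<close> is divided by \<open>n\<close>.\<close>
  define y where "y = z + ((1 / n - 1) * ip z \<xi>) *\<^sub>R \<xi>"
  have fy: "f y = z"
  proof -
    have "ip y \<xi> = ip z \<xi> / n"
      by (simp add: y_def ip_simps xi algebra_simps)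
    moreover have "(1 / n - 1) * ip z \<xi> + (n - 1) * (ip z \<xi> / n) = 0"
      using assms(2) by (simp add: field_simps)
    ultimately show ?thesis
      by (simp add: f_def) (simp add: y_def add.assoc flip: scaleR_add_left)
  qed
  have yy: "ip y y > 0"
    using f_ip[of y y] fy assms(3) by (simp add: timelike_def)
  define s where "s = sqrt (ip y y)"
  have s: "s > 0" "s * s = ip y y"
    using yy by (simp_all add: s_def)
  define u where "u = (1 / s) *\<^sub>R y"
  have u: "ip u u = 1"
    using s yy by (simp add: u_def ip_simps field_simps)
  \<comment> \<open>A reflection takes \<open>axis 0 1\<close> to \<open>\<plusminus>u\<close>; the sign is chosen so that \<open>d\<close> is timelike.\<close>
  define e :: vec4 where "e = axis 0 1"
  have e: "ip e e = 1" "ip e u = u $ 0"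
    by (simp_all add: ip_def e_def inner_eta axis_def)
  define \<sigma> :: real where "\<sigma> = (if u $ 0 \<ge> 0 then 1 else - 1)"
  have \<sigma>: "\<sigma> * \<sigma> = 1" "\<sigma> * u $ 0 \<ge> 0"
    by (auto simp: \<sigma>_def)
  define d where "d = e + \<sigma> *\<^sub>R u"
  have dd: "ip d d = 2 * ip e d" "ip d d > 0"
    using \<sigma> by (simp_all add: d_def ip_simps e u ip_sym[of u e] algebra_simps)
  \<comment> \<open>The reflection alone sends \<open>e\<close> to
    \<open>(- \<sigma>) *\<^sub>R u\<close>; the factor \<open>- \<sigma>\<close> corrects the sign
    and keeps inner products, as \<open>\<sigma> * \<sigma> = 1\<close>.\<close>
  define R where "R x = (- \<sigma>) *\<^sub>R (x - (2 * ip x d / ip d d) *\<^sub>R d)" for x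
  have lin_R: "linear R"
    by (rule linearI) (simp_all add: R_def ip_simps algebra_simps add_divide_distrib)
  have Re: "R e = u"
    using dd \<sigma> by (simp add: R_def) (simp add: d_def)
  have R_ip: "ip (R x) (R v) = ip x v" for x v
  proof -
    define p where "p = ip x d"
    define q where "q = ip v d"
    define D where "D = ip d d"
    have D: "D \<noteq> 0" using dd by (simp add: D_def)
    have "ip (R x) (R v) = (\<sigma> * \<sigma>) * (ip x v - (2 * q / D) * p - (2 * p / D) * q + (2 * p / D) * (2 * q / D) * D)"
      by (simp add: R_def ip_simps ip_sym[of d v] p_def q_def D_def algebra_simps)
    also have "\<dots> = ip x v"
      using D \<sigma> by (simp add: field_simps)
    finally show ?thesis .
  qed
  define A where "A = matrix (\<lambda>x. f (R x))"
  have A: "A *v x = f (R x)" for x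
    using fun_cong[OF matrix_vector_mul(2)[OF linear_compose[OF lin_R lin_f, unfolded o_def]]]
    by (simp add: A_def)
  let ?g = "gordon n \<xi>"
  have "(transpose A ** ?g ** A) *v y = eta *v y" for y
  proof -
    have "x \<bullet> ((transpose A ** ?g ** A) *v y) = x \<bullet> (eta *v y)" for x
      unfolding matrix_vector_mul_assoc[symmetric] inner_matrix_vector[of x "transpose A"]
        transpose_transpose A f_ip R_ip by (simp add: ip_def)
    then show ?thesis using vector_eq_ldot by blast
  qed
  then have AgA: "transpose A ** ?g ** A = eta"
    by (simp add: matrix_eq)
  \<comment> \<open>The pullback identity \<open>AgA\<close> makes this the inverse of
    \<open>A\<close>, since \<open>eta\<close> squares to the identity.\<close>
  define B where "B = eta ** transpose A ** ?g"
  have "B ** A = eta ** (transpose A ** ?g ** A)"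
    by (simp add: B_def matrix_mul_assoc)
  then have AB: "A ** B = mat 1"
    by (simp add: AgA eta_eta matrix_left_right_inverse)
  have "adapted_frame ?g (gordon_up n \<xi>) z A B s"
  proof
    have "transpose B ** eta ** B = ?g ** A ** (eta ** eta) ** B"
      by (simp add: B_def matrix_transpose_mul transpose_eta transpose_gordon matrix_mul_assoc)
    also have "\<dots> = ?g ** (A ** B)"
      by (simp add: eta_eta matrix_mul_assoc)
    finally show "?g = transpose B ** eta ** B"
      by (simp add: AB)
    \<comment> \<open>Inserting Gordon's metric times its inverse makes \<open>B\<close>
      appear.\<close>
    have "A ** eta ** transpose A = A ** eta ** transpose A ** (?g ** gordon_up n \<xi>)"
      using assms by (simp add: gordon_inverse)
    also have "\<dots> = A ** B ** gordon_up n \<xi>"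
      by (simp add: B_def matrix_mul_assoc)
    finally show "gordon_up n \<xi> = A ** eta ** transpose A"
      by (simp add: AB)
    show "z = s *\<^sub>R (A *v axis 0 1)"
      unfolding e_def[symmetric] A Re
      using s fy by (simp add: u_def linear_cmul[OF lin_f])
  qed (use AB s in auto)
  then show ?thesis by (rule that)
qed

section \<open>Smoothness and symmetry of the candidate hyperbolization\<close>

lemma C_k_bounded_linear:
  assumes "bounded_linear L" "C_k k S f"
  shows "C_k k S (\<lambda>x. L (f x))"
  using assms(2)
proof (induction k arbitrary: f)
  case 0
  then show ?case
    using bounded_linear.continuous_on[OF assms(1)] by simp
next
  case (Suc k)
  then obtain f' where f': "\<And>x. x \<in> S \<Longrightarrow> (f has_derivative f' x) (at x within S)"
      "\<And>v. v \<in> S \<Longrightarrow> C_k k S (\<lambda>x. f' x v)"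
    by auto
  have "\<forall>x\<in>S. ((\<lambda>x. L (f x)) has_derivative (\<lambda>v. L (f' x v))) (at x within S)"
    using f'(1) bounded_linear.has_derivative[OF assms(1)] by blast
  moreover have "\<forall>v\<in>S. C_k k S (\<lambda>x. L (f' x v))"
    using f'(2) Suc.IH by blast
  ultimately show ?case by auto
qed

lemma smooth_on_subspace_bounded_linear:
  "bounded_linear L \<Longrightarrow> smooth_on_subspace S f \<Longrightarrow> smooth_on_subspace S (\<lambda>x. L (f x))"
  by (simp add: smooth_on_subspace_def C_k_bounded_linear)

lemma alt3_add: "alt3 (S + T) = alt3 S + alt3 T"
  by (simp add: alt3_def vec_eq_iff field_simps)

lemma alt3_scaleR: "alt3 (r *\<^sub>R T) = r *\<^sub>R alt3 T"
  by (simp add: alt3_def vec_eq_iff field_simps)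

lemma outer_add_left: "outer (u + v) X = outer u X + outer v X"
  and outer_add_right: "outer u (X + Y) = outer u X + outer u Y"
  and outer_scaleR_left: "outer (r *\<^sub>R u) X = r *\<^sub>R outer u X"
  and outer_scaleR_right: "outer u (r *\<^sub>R X) = r *\<^sub>R outer u X"
  by (simp_all add: outer_def vec_eq_iff algebra_simps)

lemma matrix_mult_scaleR:
  "(r *\<^sub>R X) ** Y = r *\<^sub>R (X ** Y)" "X ** (r *\<^sub>R Y) = r *\<^sub>R (X ** Y)" for X Y :: tensor2
  by (simp_all add: matrix_matrix_mult_def vec_eq_iff sum_distrib_left ac_simps)

lemma matrix_mult_add_left: "(X + Y) ** Z = X ** Z + Y ** Z" for X Y Z :: tensor2
  by (simp add: matrix_matrix_mult_def vec_eq_iff distrib_right sum.distrib)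

text \<open>\<open>maxwell_h\<close> depends on the bundle point only through
  \<open>\<zeta> x\<close>, and linearly, so smoothness passes from \<open>\<zeta>\<close> through a
  bounded linear map.\<close>

lemma smooth_equation_map_maxwell_h:
  assumes "smooth_on_subspace em_bundle \<zeta>"
  shows "smooth_equation_map (maxwell_h n \<xi> \<zeta>)"
  unfolding smooth_equation_map_def
proof (intro conjI ballI allI)
  fix x \<phi>
  show "maxwell_h n \<xi> \<zeta> x \<phi> \<in> equation_space"
    by (simp add: maxwell_h_def equation_space_def alt3_scaleR alt3_idem)
next
  fix x \<phi> \<psi> r s
  show "maxwell_h n \<xi> \<zeta> x (r *\<^sub>R \<phi> + s *\<^sub>R \<psi>) = r *\<^sub>R maxwell_h n \<xi> \<zeta> x \<phi> + s *\<^sub>R maxwell_h n \<xi> \<zeta> x \<psi>"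
    by (simp add: maxwell_h_def matrix_vector_mult_add_rdistrib matrix_vector_right_distrib
        scaleR_matrix_vector_assoc[symmetric] matrix_vector_mult_scaleR
        matrix_add_ldistrib matrix_mult_add_left matrix_mult_scaleR outer_add_right
        outer_scaleR_right alt3_add alt3_scaleR scaleR_add_right mult.commute)
next
  fix \<phi>
  let ?L = "\<lambda>z. (gordon_up n \<xi> *v (\<phi> *v z),
      (3 / 2) *\<^sub>R alt3 (outer z (gordon_up n \<xi> ** \<phi> ** transpose (gordon_up n \<xi>))))"
  have "linear ?L"
    by (rule linearI) (simp_all add: matrix_vector_right_distrib matrix_vector_mult_scaleR
        outer_add_left outer_scaleR_left alt3_add alt3_scaleR scaleR_add_right)
  then show "smooth_on_subspace em_bundle (\<lambda>x. maxwell_h n \<xi> \<zeta> x \<phi>)"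
    using smooth_on_subspace_bounded_linear[OF _ assms, of ?L]
    by (simp add: maxwell_h_def linear_conv_bounded_linear)
qed

text \<open>The two mixed terms change places; the remaining term is symmetric because
  multiplication by a symmetric \<open>G\<close> on either side is self-adjoint.\<close>

lemma maxwell_form_sym:
  assumes "transpose G = G"
  shows "maxwell_form G z m \<phi> \<psi> = maxwell_form G z m \<psi> \<phi>"
proof -
  have "(G ** \<phi> ** transpose G) \<bullet> \<psi> = (G ** \<psi> ** transpose G) \<bullet> \<phi>"
    using inner_matrix_mult_right[of "G ** \<phi>" G \<psi>] inner_matrix_mult_left[of G \<phi> "\<psi> ** G"]
    by (simp add: assms inner_commute[of \<phi>] matrix_mul_assoc)
  then show ?thesis
    by (simp add: maxwell_form_def inner_commute)
qed

section \<open>Comparison of the cones of \<open>eta\<close> and of Gordon's metric\<close>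

lemma causal_eta_inner_nonzero:
  assumes "\<xi> \<bullet> (eta *v \<xi>) = 1" "causal eta v" "v \<noteq> 0"
  shows "v \<bullet> (eta *v \<xi>) \<noteq> 0"
proof -
  \<comment> \<open>For \<open>n = 1\<close> Gordon's metric is \<open>eta\<close>, and
    \<open>\<xi>\<close> itself can be the timelike leg.\<close>
  have "timelike (gordon 1 \<xi>) \<xi>"
    using assms(1) by (simp add: timelike_def gordon_1)
  from adapted_frame_gordon[OF assms(1) _ this] obtain A B s where "adapted_frame eta eta \<xi> A B s"
    by (auto simp: gordon_1)
  then interpret adapted_frame eta eta \<xi> A B s .
  show ?thesis using inner_metric_leg_nonzero assms by blast
qed

text \<open>For \<open>n > 1\<close> Gordon's correction is nonpositive, so the vector is at least
  causal for \<open>eta\<close>. Its pairing with \<open>\<xi>\<close> is then nonzero, which makes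
  the correction strictly negative and the inequality strict.\<close>

lemma timelike_eta_if_causal_gordon:
  assumes "\<xi> \<bullet> (eta *v \<xi>) = 1" "n > 1" "causal (gordon n \<xi>) v" "v \<noteq> 0"
  shows "timelike eta v"
proof -
  let ?w = "v \<bullet> (eta *v \<xi>)"
  have c: "(1 - n\<^sup>2) / n\<^sup>2 < 0"
    using assms(2) by (intro divide_neg_pos) (auto simp: power2_eq_square less_1_mult)
  have le: "(1 - n\<^sup>2) / n\<^sup>2 * (?w * ?w) + v \<bullet> (eta *v v) \<ge> 0"
    using assms(3) by (simp add: causal_alt inner_gordon mult.assoc add.commute)
  have "(1 - n\<^sup>2) / n\<^sup>2 * (?w * ?w) \<le> 0"
    using c by (intro mult_nonpos_nonneg) auto
  then have "causal eta v"
    using le by (simp add: causal_alt)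
  then have "?w \<noteq> 0"
    using causal_eta_inner_nonzero assms by blast
  then have "(1 - n\<^sup>2) / n\<^sup>2 * (?w * ?w) < 0"
    using c by (intro mult_neg_pos) (auto simp: zero_less_mult_iff)
  then show ?thesis
    using le by (simp add: timelike_def)
qed

text \<open>For \<open>n < 1\<close> the correction is strictly positive on nonzero
  \<open>eta\<close>-causal vectors, since their pairing with \<open>\<xi>\<close> does not
  vanish.\<close>

lemma timelike_gordon_if_causal_eta:
  assumes "\<xi> \<bullet> (eta *v \<xi>) = 1" "0 < n" "n < 1" "causal eta v" "v \<noteq> 0"
  shows "timelike (gordon n \<xi>) v"
proof -
  let ?w = "v \<bullet> (eta *v \<xi>)"
  have "n\<^sup>2 < 1"
    using assms(2,3) by (simp add: power2_eq_square) (metis mult_strict_mono mult_1 less_le zero_less_one)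
  then have "(1 - n\<^sup>2) / n\<^sup>2 > 0"
    using assms(2) by simp
  moreover have "?w * ?w > 0"
    using causal_eta_inner_nonzero[OF assms(1,4,5)] by (auto simp: zero_less_mult_iff)
  ultimately have "(1 - n\<^sup>2) / n\<^sup>2 * (?w * ?w) > 0"
    by (rule mult_pos_pos)
  then show ?thesis
    using assms(4) by (simp add: timelike_def inner_gordon causal_alt mult.assoc)
qed

section \<open>The causal cone of the Maxwell system and the metric lightcone\<close>

lemma lightcone_lobe_future_cone:
  assumes "adapted_frame g G z A B s"
  shows "lightcone_lobe g (insert 0 (future_cone g z))"
  using adapted_frame.future_cone_component[OF assms] by (auto simp: lightcone_lobe_def)

lemma insert_future_cone_psubset:
  "future_cone g z \<subset> future_cone g' z' \<Longrightarrow> insert 0 (future_cone g z) \<subset> insert 0 (future_cone g' z')"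
  by (auto simp: future_cone_def)

lemma positive_covectors_maxwell:
  assumes "\<xi> \<bullet> (eta *v \<xi>) = 1" "n > 0" "timelike (gordon n \<xi>) (\<zeta> x)"
  shows "positive_covectors (maxwell_k n \<xi>) (maxwell_h n \<xi> \<zeta>) x
    = {m. timelike (gordon_up n \<xi>) m \<and> m \<bullet> \<zeta> x > 0}"
proof -
  obtain A B s where "adapted_frame (gordon n \<xi>) (gordon_up n \<xi>) (\<zeta> x) A B s"
    by (rule adapted_frame_gordon[OF assms])
  from adapted_frame.maxwell_form_positive_iff[OF this] show ?thesis
    by (simp add: positive_covectors_def maxwell_contraction)
qed

lemma causal_cone_maxwell:
  assumes "\<xi> \<bullet> (eta *v \<xi>) = 1" "n > 0" "timelike (gordon n \<xi>) (\<zeta> x)"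
  shows "causal_cone (maxwell_k n \<xi>) (maxwell_h n \<xi> \<zeta>) x
    = insert 0 (future_cone (gordon n \<xi>) (\<zeta> x))"
proof -
  obtain A B s where "adapted_frame (gordon n \<xi>) (gordon_up n \<xi>) (\<zeta> x) A B s"
    by (rule adapted_frame_gordon[OF assms])
  from adapted_frame.dual_cone[OF this] show ?thesis
    unfolding causal_cone_def positive_covectors_maxwell[of \<xi> n \<zeta> x, OF assms] by simp
qed

lemma hyperbolization_maxwell:
  assumes "\<xi> \<bullet> (eta *v \<xi>) = 1" "n > 0" "smooth_on_subspace em_bundle \<zeta>"
    and "\<forall>x\<in>em_bundle. timelike (gordon n \<xi>) (\<zeta> x)"
  shows "hyperbolization (maxwell_k n \<xi>) (maxwell_h n \<xi> \<zeta>)"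
  unfolding hyperbolization_def
proof (intro conjI ballI allI)
  show "smooth_equation_map (maxwell_h n \<xi> \<zeta>)"
    by (rule smooth_equation_map_maxwell_h[OF assms(3)])
  show "maxwell_k n \<xi> x (maxwell_h n \<xi> \<zeta> x \<phi>) m \<psi> = maxwell_k n \<xi> x (maxwell_h n \<xi> \<zeta> x \<psi>) m \<phi>"
    if "\<phi> \<in> antisym_tensors" "\<psi> \<in> antisym_tensors" for x m \<phi> \<psi>
    using that by (simp add: maxwell_contraction maxwell_form_sym[OF transpose_gordon_up])
  show "\<exists>m. m \<in> positive_covectors (maxwell_k n \<xi>) (maxwell_h n \<xi> \<zeta>) x" if "x \<in> em_bundle" for x
  proof
    \<comment> \<open>\<open>\<zeta> x\<close> lowered with Gordon's metric: its norm under the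
      inverse metric and its pairing with \<open>\<zeta> x\<close> both equal the norm of
      \<open>\<zeta> x\<close>.\<close>
    let ?m = "gordon n \<xi> *v \<zeta> x"
    have z: "timelike (gordon n \<xi>) (\<zeta> x)"
      using assms(4) that by blast
    have "gordon_up n \<xi> *v ?m = \<zeta> x"
      using assms(1,2) by (simp add: matrix_vector_mul_assoc gordon_inverse)
    then show "?m \<in> positive_covectors (maxwell_k n \<xi>) (maxwell_h n \<xi> \<zeta>) x"
      unfolding positive_covectors_maxwell[of \<xi> n \<zeta> x, OF assms(1,2) z]
      using z by (simp add: timelike_def inner_commute)
  qed
qed

text \<open>For \<open>n > 1\<close> the vector \<open>\<zeta> x\<close> is timelike for
  \<open>eta\<close> too, so it also selects the lobe that receives the causal cone.\<close>

lemma causal_cone_subset_lobe: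
  assumes "\<xi> \<bullet> (eta *v \<xi>) = 1" "n > 1" "timelike (gordon n \<xi>) (\<zeta> x)"
  shows "\<exists>L. lightcone_lobe eta L \<and> causal_cone (maxwell_k n \<xi>) (maxwell_h n \<xi> \<zeta>) x \<subset> L"
proof -
  have n: "n > 0" using assms(2) by simp
  obtain A B s where f: "adapted_frame (gordon n \<xi>) (gordon_up n \<xi>) (\<zeta> x) A B s"
    by (rule adapted_frame_gordon[OF assms(1) n assms(3)])
  have "\<zeta> x \<noteq> 0"
    using assms(3) by (auto simp: timelike_def)
  then have t: "timelike eta (\<zeta> x)"
    using timelike_eta_if_causal_gordon assms by (auto simp: causal_def)
  then have "timelike (gordon 1 \<xi>) (\<zeta> x)"
    by (simp add: gordon_1)
  from adapted_frame_gordon[OF assms(1) _ this] obtain A' B' s'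
    where f': "adapted_frame eta eta (\<zeta> x) A' B' s'"
    by (auto simp: gordon_1)
  have "future_cone (gordon n \<xi>) (\<zeta> x) \<subset> future_cone eta (\<zeta> x)"
    using future_cone_psubset[OF f f'] timelike_eta_if_causal_gordon[OF assms(1,2)] t
    by (simp add: timelike_def)
  then show ?thesis
    using lightcone_lobe_future_cone[OF f'] insert_future_cone_psubset
      causal_cone_maxwell[OF assms(1) n, of \<zeta> x] assms(3) by metis
qed

text \<open>For \<open>n < 1\<close> the vector \<open>\<zeta> x\<close> can be spacelike for
  \<open>eta\<close>. The lobe is therefore selected by \<open>\<xi>\<close> up to sign, which is
  timelike for both metrics.\<close>

lemma lobe_subset_causal_cone:
  assumes "\<xi> \<bullet> (eta *v \<xi>) = 1" "0 < n" "n < 1" "timelike (gordon n \<xi>) (\<zeta> x)"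
  shows "\<exists>L. lightcone_lobe eta L \<and> L \<subset> causal_cone (maxwell_k n \<xi>) (maxwell_h n \<xi> \<zeta>) x"
proof -
  obtain A B s where f: "adapted_frame (gordon n \<xi>) (gordon_up n \<xi>) (\<zeta> x) A B s"
    by (rule adapted_frame_gordon[OF assms(1,2,4)])
  have "\<xi> \<noteq> 0" "causal eta \<xi>"
    using assms(1) by (auto simp: causal_alt)
  then have "timelike (gordon n \<xi>) \<xi>"
    using timelike_gordon_if_causal_eta assms by blast
  then have nz: "\<xi> \<bullet> (gordon n \<xi> *v \<zeta> x) \<noteq> 0"
    using adapted_frame.inner_metric_leg_nonzero[OF f] \<open>\<xi> \<noteq> 0\<close> by (simp add: causal_def)
  \<comment> \<open>The sign puts \<open>\<xi>'\<close> in the same lobe of Gordon's metric as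
    \<open>\<zeta> x\<close>.\<close>
  define \<xi>' where "\<xi>' = sgn (\<xi> \<bullet> (gordon n \<xi> *v \<zeta> x)) *\<^sub>R \<xi>"
  have pos: "\<xi>' \<bullet> (gordon n \<xi> *v \<zeta> x) > 0"
    using nz by (simp add: \<xi>'_def sgn_if)
  have "timelike (gordon 1 \<xi>) \<xi>'"
    using nz assms(1)
    by (auto simp: \<xi>'_def sgn_if timelike_def gordon_1 matrix_vector_mult_scaleR
        simp del: scaleR_minus1_left)
  from adapted_frame_gordon[OF assms(1) _ this] obtain A' B' s'
    where f': "adapted_frame eta eta \<xi>' A' B' s'"
    by (auto simp: gordon_1)
  have "future_cone eta \<xi>' \<subset> future_cone (gordon n \<xi>) (\<zeta> x)"
    using future_cone_psubset[OF f' f] timelike_gordon_if_causal_eta[OF assms(1-3)] pos by blast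
  then show ?thesis
    using lightcone_lobe_future_cone[OF f'] insert_future_cone_psubset
      causal_cone_maxwell[OF assms(1,2), of \<zeta> x] assms(4) by metis
qed

theorem mainTheorem1:
  fixes \<xi> :: "real ^ 4" and \<epsilon> \<mu> n :: real
    and \<zeta> :: "(real ^ 4) \<times> (real ^ 4 ^ 4) \<Rightarrow> real ^ 4"
  assumes "timelike eta \<xi>" and "\<xi> \<bullet> (eta *v \<xi>) = 1"
    and "\<epsilon> > 0" and "\<mu> > 0" and "n = sqrt (\<epsilon> * \<mu>)"
    and "smooth_on_subspace em_bundle \<zeta>"
    and "\<forall>x\<in>em_bundle. timelike (gordon n \<xi>) (\<zeta> x)"
  shows
    "hyperbolization (maxwell_k n \<xi>) (maxwell_h n \<xi> \<zeta>) \<and>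
     (\<forall>x\<in>em_bundle.
        positive_covectors (maxwell_k n \<xi>) (maxwell_h n \<xi> \<zeta>) x
          = {m. timelike (gordon_up n \<xi>) m \<and> m \<bullet> \<zeta> x > 0} \<and>
        causal_cone (maxwell_k n \<xi>) (maxwell_h n \<xi> \<zeta>) x
          = insert 0 {v. v \<noteq> 0 \<and> causal (gordon n \<xi>) v \<and> v \<bullet> (gordon n \<xi> *v \<zeta> x) > 0}) \<and>
     (n > 1 \<longrightarrow> (\<forall>x\<in>em_bundle. \<exists>L. lightcone_lobe eta L \<and>
        causal_cone (maxwell_k n \<xi>) (maxwell_h n \<xi> \<zeta>) x \<subset> L)) \<and>
     (n < 1 \<longrightarrow> (\<forall>x\<in>em_bundle. \<exists>L. lightcone_lobe eta L \<and>
        L \<subset> causal_cone (maxwell_k n \<xi>) (maxwell_h n \<xi> \<zeta>) x) \<and>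
        geroch_earman_superluminal (\<lambda>p. eta) (maxwell_k n \<xi>) (maxwell_h n \<xi> \<zeta>))"
proof -
  have n: "n > 0"
    using assms(3-5) by simp
  have tl: "timelike (gordon n \<xi>) (\<zeta> x)" if "x \<in> em_bundle" for x
    using assms(7) that by blast
  have wide: "\<forall>x\<in>em_bundle. \<exists>L. lightcone_lobe eta L \<and>
      L \<subset> causal_cone (maxwell_k n \<xi>) (maxwell_h n \<xi> \<zeta>) x" if "n < 1"
    using lobe_subset_causal_cone[OF assms(2) n that] tl by blast
  \<comment> \<open>The zero field at the origin shows that the whole bundle, taken as the open set,
    is nonempty.\<close>
  have "(0, 0) \<in> em_bundle"
    by (simp add: em_bundle_def antisym_tensors_def transpose_def vec_eq_iff)
  then have "geroch_earman_superluminal (\<lambda>p. eta) (maxwell_k n \<xi>) (maxwell_h n \<xi> \<zeta>)" if "n < 1"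
    unfolding geroch_earman_superluminal_def using wide[OF that]
    by (intro exI[of _ em_bundle]) auto
  moreover have "\<forall>x\<in>em_bundle. \<exists>L. lightcone_lobe eta L \<and>
      causal_cone (maxwell_k n \<xi>) (maxwell_h n \<xi> \<zeta>) x \<subset> L" if "n > 1"
    using causal_cone_subset_lobe[OF assms(2) that] tl by blast
  ultimately show ?thesis
    using wide hyperbolization_maxwell[OF assms(2) n assms(6,7)]
      positive_covectors_maxwell[OF assms(2) n tl] causal_cone_maxwell[OF assms(2) n tl]
    by (simp add: future_cone_def)
qed

end
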